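(* Let $U:\mathbb{R}\to\mathbb{S}^1\subset\mathbb{R}^2$ be defined by $$U(x)=\begin{pmatrix}\frac{x^2-1}{x^2+1}\\[2pt] \frac{-2x}{x^2+1}\end{pmatrix}.$$ Consider the linearized half-harmonic map equation at $U$: for $v:\mathbb{R}\to\mathbb{R}^2$ with $v(x)\cdot U(x)=0$ for all $x\in\mathbb{R}$, $$(-\Delta_{\mathbb{R}})^{1/2}v(x)=\left(\frac{1}{2\pi}\int_{\mathbb{R}}\frac{|U(x)-U(y)|^2}{|x-y|^2}\,dy\right)v(x)+\left(\frac{1}{\pi}\int_{\mathbb{R}}\frac{(U(x)-U(y))\cdot(v(x)-v(y))}{|x-y|^2}\,dy\right)U(x)\quad\text{in }\mathbb{R}.$$ Then every bounded solution $v$ of this equation is a linear combination (with real coefficients) of $$Z_1(x)=\begin{pmatrix}\frac{2x}{x^2+1}\\[2pt] \frac{x^2-1}{x^2+1}\end{pmatrix},\quad Z_2(x)=\begin{pmatrix}\frac{-4x}{(x^2+1)^2}\\[2pt] \frac{2(1-x^2)}{(x^2+1)^2}\end{pmatrix},\quad Z_3(x)=\begin{pmatrix}\frac{-4x^2}{(x^2+1)^2}\\[2pt] \frac{2x(1-x^2)}{(x^2+1)^2}\end{pmatrix}.$$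
   Context: $(-\Delta_{\mathbb{R}})^{1/2}$ denotes the half-Laplacian on $\mathbb{R}$, acting componentwise, given by $(-\Delta_{\mathbb{R}})^{1/2}f(x)=\frac{1}{\pi}\,\mathrm{P.V.}\int_{\mathbb{R}}\frac{f(x)-f(y)}{|x-y|^2}\,dy$. The map $U$ is a half-harmonic map, i.e. a solution of $(-\Delta_{\mathbb{R}})^{1/2}u=\left(\frac{1}{2\pi}\int_{\mathbb{R}}\frac{|u(x)-u(y)|^2}{|x-y|^2}dy\right)u$ with values in $\mathbb{S}^1$; the functions $Z_1,Z_2,Z_3$ arise from rotation, translation and dilation of $U$ respectively. The tangency condition $v(x)\cdot U(x)=0$ means $v$ takes values in $T_{U(x)}\mathbb{S}^1$. *)

theory Defs
  imports "HOL-Analysis.Analysis"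
begin

definition U :: "real \<Rightarrow> real^2" where
  "U x = vector [(x^2 - 1) / (x^2 + 1), (-2 * x) / (x^2 + 1)]"

definition Z1 :: "real \<Rightarrow> real^2" where
  "Z1 x = vector [(2 * x) / (x^2 + 1), (x^2 - 1) / (x^2 + 1)]"

definition Z2 :: "real \<Rightarrow> real^2" where
  "Z2 x = vector [(-4 * x) / (x^2 + 1)^2, (2 * (1 - x^2)) / (x^2 + 1)^2]"

definition Z3 :: "real \<Rightarrow> real^2" where
  "Z3 x = vector [(-4 * x^2) / (x^2 + 1)^2, (2 * x * (1 - x^2)) / (x^2 + 1)^2]"

definition pv_has_value ::
  "(real \<Rightarrow> 'a::{banach,second_countable_topology}) \<Rightarrow> real \<Rightarrow> 'a \<Rightarrow> bool" where
  "pv_has_value g x L \<longleftrightarrow>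
     (\<forall>e>0. set_integrable lborel {y. e < \<bar>x - y\<bar>} g) \<and>
     ((\<lambda>e. (LINT y:{y. e < \<bar>x - y\<bar>}|lborel. g y)) \<longlongrightarrow> L) (at_right 0)"

definition half_laplacian_at :: "(real \<Rightarrow> real^2) \<Rightarrow> real \<Rightarrow> real^2 \<Rightarrow> bool" where
  "half_laplacian_at f x L \<longleftrightarrow>
     (\<exists>P. pv_has_value (\<lambda>y. (1 / \<bar>x - y\<bar>^2) *\<^sub>R (f x - f y)) x P \<and> L = (1 / pi) *\<^sub>R P)"

definition energy_U :: "real \<Rightarrow> real" where
  "energy_U x = (1 / (2 * pi)) * (LINT y|lborel. (norm (U x - U y))^2 / \<bar>x - y\<bar>^2)"

text \<open>v solves the linearized equation at the point x. The second integral is taken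
  in the principal-value sense (it agrees with the ordinary integral when that converges).\<close>

definition lin_eq_at :: "(real \<Rightarrow> real^2) \<Rightarrow> real \<Rightarrow> bool" where
  "lin_eq_at v x \<longleftrightarrow>
     (\<exists>L M. half_laplacian_at v x L \<and>
        pv_has_value (\<lambda>y. ((U x - U y) \<bullet> (v x - v y)) / \<bar>x - y\<bar>^2) x M \<and>
        L = energy_U x *\<^sub>R v x + (M / pi) *\<^sub>R U x)"

end

theory Submission
  imports Defs "HOL-Complex_Analysis.Complex_Analysis" "HOL-Real_Asymp.Real_Asymp"
begin

text \<open>
  Writing \<open>v = w Z1\<close>, the equation turns into the pointwise scalar equation
  \<open>|D| w = \<rho> (w - c)\<close> with \<open>\<rho>(x) = 2 / (1 + x\<^sup>2)\<close> and \<open>c\<close> the mean of \<open>w\<close> for the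
  density \<open>1 / (\<pi> (1 + x\<^sup>2))\<close>; one may assume \<open>c = 0\<close>.  As \<open>w\<close> is only bounded and
  measurable, the difficulty is to pass from this pointwise principal value equation to
  \<open>- \<partial>\<^sub>y u = P[\<rho> w]\<close> in the upper half-plane, where \<open>u = P[w]\<close> is the Poisson extension.
  This is done by Riemann's method for trigonometric series: up to a smooth term, \<open>|D|\<^sup>-\<^sup>1 w\<close> is
  the continuous function \<open>V = \<integral> u(\<cdot>, \<eta>) d\<eta>\<close> (over \<open>0 < \<eta> < 1\<close>), and the principal value at \<open>x\<close>
  gives a generalized second derivative of \<open>V\<close> at \<open>x\<close>, the limit of means against the positive
  kernels \<open>2 P\<^sub>h - P\<^sub>2\<^sub>h\<close>.  A continuous function whose
  generalized second derivative vanishes everywhere is affine, by the maximum principle.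

  Let \<open>F\<close> be the holomorphic function on the half-plane with real part \<open>u\<close> given by the Cauchy
  integral.  Then \<open>Re (- i F' - 2 F / (1 + z\<^sup>2)) = 0\<close>, so that \<open>- i F' - 2 F / (1 + z\<^sup>2)\<close> is a constant,
  which must vanish because \<open>F\<close> is holomorphic at \<open>i\<close>.  Hence \<open>F = K (z - i) / (z + i)\<close>, and \<open>w\<close> is
  the boundary value of \<open>Re F\<close>.
\<close>

section \<open>The Poisson kernel\<close>

text \<open>\<open>U x\<close> and \<open>Z1 x\<close> form an orthonormal basis, and the second
  integral enters the equation only as a multiple of \<open>U x\<close>; pairing with
  \<open>Z1 x\<close> therefore removes it. The obstacle is that the principal value converges at
  each point with no uniformity in x, so the equation cannot be integrated in x against a Poisson
  kernel. The affine step repairs this: it turns a pointwise limit into an identity valid for every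
  h > 0, one side of which is bounded uniformly in h and x by the supremum of the source. Dominated
  convergence then applies. The integral defining V stops at height 1 because it need not converge
  up to infinity. The price is the vertical derivative at height 1, a bounded continuous term that
  cancels at the end. Read as a complex number, \<open>U x\<close> is (x - i) / (x + i). Hence w is
  c plus the real part of K times U, and the three real parameters c, Re K, Im K account for the
  three Jacobi fields.\<close>

lemma lborel_integral_FTC_nonneg:
  fixes f F :: "real \<Rightarrow> real"
  assumes deriv: "\<And>x. (F has_real_derivative f x) (at x)"
    and cont: "\<And>x. isCont f x" and nonneg: "\<And>x. 0 \<le> f x"
    and bot: "(F \<longlongrightarrow> A) at_bot" and top: "(F \<longlongrightarrow> B) at_top"
  shows "integrable lborel f" "(LINT x|lborel. f x) = B - A"
proof -
  have 1: "((F \<circ> real_of_ereal) \<longlongrightarrow> A) (at_right (-\<infinity>))"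
    using bot by (simp add: ereal_tendsto_simps)
  have 2: "((F \<circ> real_of_ereal) \<longlongrightarrow> B) (at_left \<infinity>)"
    using top by (simp add: ereal_tendsto_simps)
  have "(-\<infinity>::ereal) < \<infinity>" by simp
  from interval_integral_FTC_nonneg[of "-\<infinity>" \<infinity> F f A B, OF this deriv cont _ 1 2] nonneg
  have "set_integrable lborel (einterval (-\<infinity>) \<infinity>) f" "(LBINT x=-\<infinity>..\<infinity>. f x) = B - A"
    by auto
  then show "integrable lborel f" "(LINT x|lborel. f x) = B - A"
    by (simp_all add: interval_lebesgue_integral_def set_integrable_def set_lebesgue_integral_def einterval_def)
qed

definition poisson :: "real \<Rightarrow> real \<Rightarrow> real" where
  "poisson a s = a / (pi * (s^2 + a^2))"

lemma poisson_measurable [measurable (raw)]: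
  assumes [measurable]: "f \<in> borel_measurable M" "g \<in> borel_measurable M"
  shows "(\<lambda>x. poisson (f x) (g x)) \<in> borel_measurable M"
  unfolding poisson_def by measurable

lemma poisson_nonneg: "0 \<le> a \<Longrightarrow> 0 \<le> poisson a s"
  by (simp add: poisson_def)

lemma poisson_minus [simp]: "poisson a (- s) = poisson a s"
  by (simp add: poisson_def)

lemma sum_squares_pos: "a > 0 \<Longrightarrow> s^2 + a^2 > (0::real)"
  by (simp add: add_nonneg_pos)

lemma
  assumes "a > 0"
  shows poisson_integrable: "integrable lborel (poisson a)"
    and poisson_integral: "(LINT s|lborel. poisson a s) = 1"
proof -
  note p = sum_squares_pos[OF assms]
  have nz: "s^2 + a^2 \<noteq> 0" for s :: real using p[of s] by linarith
  have d: "((\<lambda>s. arctan (s / a) / pi) has_real_derivative poisson a s) (at s)" for s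
  proof -
    have "inverse (1 + (s/a)^2) / a / pi = poisson a s"
      using assms p[of s] by (simp add: poisson_def divide_simps power2_eq_square)
    then show ?thesis using assms by (auto intro!: derivative_eq_intros)
  qed
  have c: "isCont (poisson a) s" for s
    unfolding poisson_def using nz by (intro continuous_intros) auto
  have b: "((\<lambda>s. arctan (s / a) / pi) \<longlongrightarrow> -(1/2)) at_bot"
    using assms by real_asymp
  have t: "((\<lambda>s. arctan (s / a) / pi) \<longlongrightarrow> 1/2) at_top"
    using assms by real_asymp
  from lborel_integral_FTC_nonneg[OF d c poisson_nonneg b t] assms
  show "integrable lborel (poisson a)" "(LINT s|lborel. poisson a s) = 1" by simp_all
qed

text \<open>The case \<open>X = 0\<close> is left out since the partial fraction decomposition used here degenerates
  for \<open>X = 0\<close>, \<open>a = b\<close>; the identity is only needed for almost every \<open>X\<close>.\<close>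

lemma poisson_convolution:
  assumes "a > 0" "b > 0" "X \<noteq> 0"
  shows "(LINT s|lborel. poisson a s * poisson b (X - s)) = poisson (a + b) X"
proof -
  \<comment> \<open>D is the resultant of the polynomials s^2 + a^2 and (s - X)^2 + b^2, the common
    denominator of the partial fractions; F below is the resulting antiderivative.\<close>
  define D where "D = (X^2 + (a-b)^2) * (X^2 + (a+b)^2)"
  have D: "D > 0" unfolding D_def using assms by (intro mult_pos_pos) (auto intro: add_pos_nonneg)
  define F where "F s = (a * b / (pi^2 * D)) * (X * (ln (s^2 + a^2) - ln ((s-X)^2 + b^2))
     + (X^2 + b^2 - a^2) / a * arctan (s/a) + (X^2 + a^2 - b^2) / b * arctan ((s-X)/b))" for s
  have pa: "s^2 + a^2 > 0" for s using sum_squares_pos assms by auto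
  have pb: "(s-X)^2 + b^2 > 0" for s using sum_squares_pos assms by auto
  have at: "inverse (1 + (s/a)^2) = a^2 / (s^2+a^2)" for s
    using assms pa[of s] by (simp add: divide_simps power2_eq_square)
  have at2: "inverse (1 + ((s-X)/b)^2) = b^2 / ((s-X)^2+b^2)" for s
    using assms pb[of s] by (simp add: divide_simps power2_eq_square)
  have key: "X * (2 * s / p - 2 * (s-X) / q) + (X^2 + b^2 - a^2) / p + (X^2 + a^2 - b^2) / q
        = D / (p * q)" if "p = s^2 + a^2" "q = (s-X)^2 + b^2" for s p q
  proof -
    have "p > 0" "q > 0" using that pa pb by auto
    moreover have "X * (2 * s * q - 2 * (s-X) * p) + (X^2 + b^2 - a^2) * q + (X^2 + a^2 - b^2) * p = D"
      unfolding that D_def by algebra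
    moreover have "X * (A / p - B / q) + C / p + E / q = (X * (A * q - B * p) + C * q + E * p) / (p * q)"
      if "p > 0" "q > 0" for A B C E :: real
      using that by (simp add: field_simps)
    ultimately show ?thesis by simp
  qed
  have d: "(F has_real_derivative (poisson a s * poisson b (X - s))) (at s)" for s
  proof -
    have "(F has_real_derivative (a * b / (pi^2 * D)) * (X * (2 * s / (s^2+a^2) - 2 * (s-X) / ((s-X)^2+b^2))
      + (X^2 + b^2 - a^2) / (s^2+a^2) + (X^2 + a^2 - b^2) / ((s-X)^2+b^2))) (at s)"
      unfolding F_def using assms pa[of s] pb[of s]
      by (auto intro!: derivative_eq_intros simp: at at2)
        (use D in \<open>simp_all add: power2_eq_square\<close>)
    moreover have "(a * b / (pi^2 * D)) * (D / ((s^2+a^2) * ((s-X)^2+b^2))) = poisson a s * poisson b (X - s)"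
      using D by (simp add: poisson_def power2_eq_square[of pi] power2_commute[of X s])
    ultimately show ?thesis unfolding key[OF refl refl] by (simp only:)
  qed
  have nz: "s^2 + a^2 \<noteq> 0" "(X-s)^2 + b^2 \<noteq> 0" for s :: real
    using pa[of s] pb[of s] by (auto simp: power2_commute)
  have c: "isCont (\<lambda>s. poisson a s * poisson b (X - s)) s" for s
    unfolding poisson_def using nz by (intro continuous_intros) auto
  have n: "0 \<le> poisson a s * poisson b (X - s)" for s
    using assms by (simp add: poisson_nonneg)
  \<comment> \<open>The logarithms cancel at both ends and the arctangents take opposite values
    there, so the integral is twice the value C of F at infinity.\<close>
  define C where "C = (a * b / (pi^2 * D)) * ((X^2 + b^2 - a^2) / a * (pi/2) + (X^2 + a^2 - b^2) / b * (pi/2))"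
  have l: "((\<lambda>s. ln (s^2 + a^2) - ln ((s-X)^2 + b^2)) \<longlongrightarrow> 0) at_top"
          "((\<lambda>s. ln (s^2 + a^2) - ln ((s-X)^2 + b^2)) \<longlongrightarrow> 0) at_bot"
    by real_asymp+
  have r: "((\<lambda>s. arctan (s/a)) \<longlongrightarrow> pi/2) at_top" "((\<lambda>s. arctan (s/a)) \<longlongrightarrow> -(pi/2)) at_bot"
          "((\<lambda>s. arctan ((s-X)/b)) \<longlongrightarrow> pi/2) at_top" "((\<lambda>s. arctan ((s-X)/b)) \<longlongrightarrow> -(pi/2)) at_bot"
    using assms by real_asymp+
  have t: "(F \<longlongrightarrow> (a * b / (pi^2 * D)) * (X * 0 + (X^2 + b^2 - a^2) / a * (pi/2) + (X^2 + a^2 - b^2) / b * (pi/2))) at_top"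
    unfolding F_def by (intro tendsto_mult tendsto_add tendsto_const l r)
  have b: "(F \<longlongrightarrow> (a * b / (pi^2 * D)) * (X * 0 + (X^2 + b^2 - a^2) / a * -(pi/2) + (X^2 + a^2 - b^2) / b * -(pi/2))) at_bot"
    unfolding F_def by (intro tendsto_mult tendsto_add tendsto_const l r)
  note res = lborel_integral_FTC_nonneg[OF d c n b t]
  have e2: "k * (X * 0 + P * p + Q * p) - k * (X * 0 + P * - p + Q * - p) = 2 * (k * (P * p + Q * p))"
    for k P Q p :: real by algebra
  have "2 * C = poisson (a + b) X"
  proof -
    have "b * (X^2 + b^2 - a^2) + a * (X^2 + a^2 - b^2) = (a + b) * (X^2 + (a-b)^2)" by algebra
    then have e: "(X^2 + b^2 - a^2) / a + (X^2 + a^2 - b^2) / b = (a + b) * (X^2 + (a-b)^2) / (a * b)"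
      using assms by (simp add: field_simps)
    have x: "X^2 + (a-b)^2 > 0" "X^2 + (a+b)^2 > 0" using assms by (auto intro: add_pos_nonneg)
    have "2 * C = (a * b / (pi * D)) * ((X^2 + b^2 - a^2) / a + (X^2 + a^2 - b^2) / b)"
    proof -
      have "2 * (m / (pi^2 * D) * (P * (pi/2) + Q * (pi/2))) = m / (pi * D) * (P + Q)" for m P Q :: real
        using D by (simp add: field_simps power2_eq_square)
      then show ?thesis unfolding C_def .
    qed
    also have "\<dots> = (a + b) * (X^2 + (a-b)^2) / (pi * D)"
      unfolding e using assms by simp
    also have "\<dots> = poisson (a + b) X"
      unfolding D_def poisson_def using x assms by (simp add: mult.commute)
    finally show ?thesis .
  qed
  then show "(LINT s|lborel. poisson a s * poisson b (X - s)) = poisson (a + b) X"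
    unfolding res(2) e2 C_def .
qed

section \<open>Poisson extensions\<close>

text \<open>Formulated for \<open>at a within S\<close> so that one statement serves limits from the
  right at 0 and two-sided limits, with the majorant demanded only for parameters in S.\<close>

lemma tendsto_lebesgue_integral_dominated:
  fixes s :: "real \<Rightarrow> 'a \<Rightarrow> 'b::{banach, second_countable_topology}"
  assumes lim: "\<And>x. ((\<lambda>h. s h x) \<longlongrightarrow> f x) (at a within S)"
    and meas [measurable]: "\<And>h. h \<in> S \<Longrightarrow> s h \<in> borel_measurable M" "f \<in> borel_measurable M"
    and bound: "\<And>h x. h \<in> S \<Longrightarrow> norm (s h x) \<le> g x" and g: "integrable M g"
  shows "((\<lambda>h. LINT x|M. s h x) \<longlongrightarrow> (LINT x|M. f x)) (at a within S)"
  unfolding tendsto_at_iff_sequentially comp_def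
proof (intro allI impI)
  fix X :: "nat \<Rightarrow> real"
  assume X: "\<forall>i. X i \<in> S - {a}" "X \<longlonglongrightarrow> a"
  show "(\<lambda>i. LINT x|M. s (X i) x) \<longlonglongrightarrow> (LINT x|M. f x)"
  proof (rule integral_dominated_convergence[where w=g])
    show "AE x in M. (\<lambda>i. s (X i) x) \<longlonglongrightarrow> f x"
      using lim X unfolding tendsto_at_iff_sequentially comp_def by blast
  qed (use X bound g meas in auto)
qed

lemma lborel_integral_swap:
  fixes f :: "real \<Rightarrow> real \<Rightarrow> real"
  assumes f [measurable]: "case_prod f \<in> borel_measurable (lborel \<Otimes>\<^sub>M lborel)"
    and g [measurable]: "case_prod g \<in> borel_measurable (lborel \<Otimes>\<^sub>M lborel)"
    and le: "\<And>x y. \<bar>f x y\<bar> \<le> g x y"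
    and int1: "\<And>x. integrable lborel (\<lambda>y. g x y)"
    and int2: "integrable lborel (\<lambda>x. LINT y|lborel. g x y)"
  shows "(LINT x|lborel. LINT y|lborel. f x y) = (LINT y|lborel. LINT x|lborel. f x y)"
proof -
  have g0: "g x y \<ge> 0" for x y using le[of x y] by linarith
  have "integrable (lborel \<Otimes>\<^sub>M lborel) (case_prod g)"
    by (rule lborel_pair.Fubini_integrable) (use int1 int2 g0 in auto)
  then have i: "integrable (lborel \<Otimes>\<^sub>M lborel) (case_prod f)"
    by (rule Bochner_Integration.integrable_bound) (use le g0 in auto)
  show "(LINT x|lborel. LINT y|lborel. f x y) = (LINT y|lborel. LINT x|lborel. f x y)"
    using lborel_pair.Fubini_integral[OF i] by simp
qed

lemma lborel_integral_swap_product: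
  fixes f :: "real \<Rightarrow> real \<Rightarrow> real"
  assumes f [measurable]: "case_prod f \<in> borel_measurable (lborel \<Otimes>\<^sub>M lborel)"
    and le: "\<And>x y. \<bar>f x y\<bar> \<le> a x * b y"
    and a: "integrable lborel a" and b: "integrable lborel b"
  shows "(LINT x|lborel. LINT y|lborel. f x y) = (LINT y|lborel. LINT x|lborel. f x y)"
proof -
  have [measurable]: "a \<in> borel_measurable lborel" "b \<in> borel_measurable lborel" using a b by auto
  have m: "(\<lambda>(x, y). a x * b y) \<in> borel_measurable (lborel \<Otimes>\<^sub>M lborel)" by measurable
  show "(LINT x|lborel. LINT y|lborel. f x y) = (LINT y|lborel. LINT x|lborel. f x y)"
    by (rule lborel_integral_swap[OF f m le]; use a b in simp)
qed

lemma poisson_shift_integrable: "y > 0 \<Longrightarrow> integrable lborel (\<lambda>t. poisson y (t - x))"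
  using lborel_integrable_real_affine[OF poisson_integrable, of y 1 "-x"] by (simp add: add.commute)

lemma poisson_shift_integral: "y > 0 \<Longrightarrow> (LINT t|lborel. poisson y (t - x)) = 1"
  using lborel_integral_real_affine[of 1 "poisson y" "-x"] poisson_integral by (simp add: add.commute)

locale bounded_borel =
  fixes w :: "real \<Rightarrow> real" and M :: real
  assumes measurable_w [measurable]: "w \<in> borel_measurable borel" and bound_w: "\<bar>w x\<bar> \<le> M"
begin

lemma M_nonneg: "0 \<le> M"
  using bound_w[of 0] by linarith

text \<open>The integral alone would give 0 at height 0, because \<open>poisson 0\<close> vanishes.
  With \<open>w\<close> as boundary value the semigroup law extends to b = 0, and difference
  quotients in the height make sense at the boundary.\<close>

definition ext :: "real \<Rightarrow> real \<Rightarrow> real" where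
  "ext x y = (if y = 0 then w x else LINT t|lborel. poisson y (t - x) * w t)"

lemma ext_0 [simp]: "ext x 0 = w x"
  by (simp add: ext_def)

lemma integrable_mult_w: "integrable lborel g \<Longrightarrow> integrable lborel (\<lambda>t. g t * w t)"
  by (rule Bochner_Integration.integrable_bound[of _ "\<lambda>t. M * g t"])
    (use bound_w M_nonneg in \<open>auto simp: abs_mult mult.commute[of M] intro!: mult_left_mono\<close>)

lemma ext_shift: "y > 0 \<Longrightarrow> ext x y = (LINT s|lborel. poisson y s * w (x + s))"
  using lborel_integral_real_affine[of 1 "\<lambda>t. poisson y (t - x) * w t" x] by (simp add: ext_def)

lemma ext_bound: assumes "y \<ge> 0" shows "\<bar>ext x y\<bar> \<le> M"
proof (cases "y = 0")
  case False
  with assms have y: "y > 0" by simp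
  have "\<bar>LINT t|lborel. poisson y (t - x) * w t\<bar> \<le> (LINT t|lborel. M * poisson y (t - x))"
    using bound_w M_nonneg y poisson_shift_integrable[OF y]
    by (intro integral_abs_bound_integral)
      (auto simp: abs_mult poisson_nonneg mult.commute[of M] intro!: mult_left_mono integrable_mult_w)
  then show ?thesis using y poisson_shift_integral[OF y] by (simp add: ext_def)
qed (use bound_w in simp)

lemma ext_measurable [measurable (raw)]:
  assumes [measurable]: "f \<in> borel_measurable N" "g \<in> borel_measurable N"
  shows "(\<lambda>z. ext (f z) (g z)) \<in> borel_measurable N"
  unfolding ext_def by measurable

lemma ext_semigroup:
  assumes a: "a > 0" and b: "b \<ge> 0"
  shows "(LINT s|lborel. poisson a s * ext (x + s) b) = ext x (a + b)"
proof (cases "b = 0")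
  case True
  then show ?thesis using ext_shift[OF a] by simp
next
  case False
  with b have b: "b > 0" by simp
  have "(LINT s|lborel. poisson a s * ext (x + s) b)
      = (LINT s|lborel. LINT t|lborel. poisson a s * poisson b (t - x - s) * w t)"
    using b by (auto simp: ext_def algebra_simps simp flip: integral_mult_right_zero)
  also have "\<dots> = (LINT t|lborel. LINT s|lborel. poisson a s * poisson b (t - x - s) * w t)"
  proof (rule lborel_integral_swap[where g="\<lambda>s t. M * (poisson a s * poisson b (t - (x + s)))"])
    show "integrable lborel (\<lambda>t. M * (poisson a s * poisson b (t - (x + s))))" for s
      using poisson_shift_integrable[OF b, of "x + s"] by auto
    show "integrable lborel (\<lambda>s. LINT t|lborel. M * (poisson a s * poisson b (t - (x + s))))"
      using poisson_shift_integral[OF b] poisson_integrable[OF a] by auto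
    show "\<bar>poisson a s * poisson b (t - x - s) * w t\<bar> \<le> M * (poisson a s * poisson b (t - (x + s)))" for s t
      using bound_w[of t] a b by (auto simp: abs_mult poisson_nonneg diff_diff_eq mult.commute intro!: mult_right_mono)
  qed auto
  also have "\<dots> = (LINT t|lborel. poisson (a + b) (t - x) * w t)"
  proof (rule integral_cong_AE)
    have "AE t in lborel. t \<noteq> x" by (rule AE_lborel_singleton)
    then show "AE t in lborel. (LINT s|lborel. poisson a s * poisson b (t - x - s) * w t)
        = poisson (a + b) (t - x) * w t"
      by eventually_elim (use a b poisson_convolution[of a b] in simp)
  qed auto
  finally show ?thesis using a b by (simp add: ext_def)
qed

end

section \<open>The Cauchy transform\<close>

lemma has_field_derivativeI_quadratic:
  fixes f :: "'a::real_normed_field \<Rightarrow> 'a"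
  assumes r: "r > 0" and le: "\<And>h. norm h < r \<Longrightarrow> norm (f (z + h) - f z - h * D) \<le> C * norm h ^ 2"
  shows "(f has_field_derivative D) (at z)"
  unfolding DERIV_def
proof (rule LIM_zero_cancel, rule Lim_null_comparison)
  have "eventually (\<lambda>h::'a. norm h < r) (at 0)"
    unfolding eventually_at using r by (auto simp: dist_norm)
  moreover have "eventually (\<lambda>h::'a. h \<noteq> 0) (at 0)"
    by (simp add: eventually_at_filter)
  ultimately show "eventually (\<lambda>h. norm ((f (z + h) - f z) / h - D) \<le> C * norm h) (at 0)"
  proof eventually_elim
    case (elim h)
    have "norm ((f (z + h) - f z) / h - D) = norm (f (z + h) - f z - h * D) / norm h"
      using elim by (simp add: field_simps flip: norm_divide)
    also have "\<dots> \<le> C * norm h ^ 2 / norm h"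
      by (intro divide_right_mono le elim) auto
    finally show ?case using elim by (simp add: power2_eq_square)
  qed
  show "((\<lambda>h. C * norm h) \<longlongrightarrow> 0) (at 0)"
    by (auto intro!: tendsto_eq_intros)
qed

lemma cauchy_kernel_norm:
  "y > 0 \<Longrightarrow> 1 / (norm (of_real t - Complex x y))^2 = (pi / y) * poisson y (t - x)"
  by (simp add: poisson_def cmod_power2)

lemma of_real_neq_upper: "Im z > 0 \<Longrightarrow> of_real t - z \<noteq> 0"
  by (auto simp: complex_eq_iff)

lemma cauchy_kernel_sq_integrable: "Im z > 0 \<Longrightarrow> integrable lborel (\<lambda>t. 1 / (norm (of_real t - z))^2)"
  using cauchy_kernel_norm[of "Im z" _ "Re z"] poisson_shift_integrable[of "Im z" "Re z"] by simp

lemma cauchy_kernel_sq_integral: "Im z > 0 \<Longrightarrow> (LINT t|lborel. 1 / (norm (of_real t - z))^2) = pi / Im z"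
  using cauchy_kernel_norm[of "Im z" _ "Re z"] poisson_shift_integral[of "Im z" "Re z"] by simp

lemma cauchy_kernel_i: "1 / (of_real t - \<i>) - of_real (t / (1 + t^2)) = \<i> * of_real (1 / (1 + t^2))"
proof -
  define p q :: complex where "p = of_real t - \<i>" and "q = of_real t + \<i>"
  have nz: "p \<noteq> 0" "q \<noteq> 0" by (auto simp: p_def q_def complex_eq_iff)
  have "1 / p - of_real t / (p * q) = (q - of_real t) / (p * q)" using nz by (simp add: field_simps)
  moreover have "p * q = of_real (1 + t^2)" by (simp add: p_def q_def algebra_simps power2_eq_square)
  ultimately show ?thesis by (simp add: p_def q_def)
qed

text \<open>Compare with the pole at i. The difference of the two Cauchy kernels is z - i times
  their product, and both factors are square integrable; what remains is the kernel at i, of size 1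
  / (1 + t^2) by \<open>cauchy_kernel_i\<close>.\<close>

lemma cauchy_kernel_integrable:
  assumes z: "Im z > 0"
  shows "integrable lborel (\<lambda>t. 1 / (of_real t - z) - of_real (t / (1 + t^2)))" (is "integrable _ ?k")
proof (rule Bochner_Integration.integrable_bound)
  show "integrable lborel (\<lambda>t. (norm (z - \<i>) + 1) * (1 / (norm (of_real t - z))^2 + 1 / (norm (of_real t - \<i>))^2))"
    using z by (intro integrable_mult_right Bochner_Integration.integrable_add cauchy_kernel_sq_integrable) auto
  have "norm (?k t) \<le> (norm (z - \<i>) + 1) * (1 / (norm (of_real t - z))^2 + 1 / (norm (of_real t - \<i>))^2)" for t
  proof -
    define a b where "a = 1 / (of_real t - z)" and "b = 1 / (of_real t - \<i>)"
    have nz: "of_real t - z \<noteq> 0" "of_real t - \<i> \<noteq> 0" using of_real_neq_upper z by auto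
    have "?k t = (z - \<i>) * (a * b) + \<i> * of_real (1 / (1 + t^2))"
    proof -
      have "1 / p - 1 / q = (q - p) * (1 / p * (1 / q))" if "p \<noteq> 0" "q \<noteq> 0" for p q :: complex
        using that by (simp add: field_simps)
      from this[OF nz] have "a - b = (z - \<i>) * (a * b)" by (simp add: a_def b_def)
      moreover have "?k t = (a - b) + (b - of_real (t / (1 + t^2)))" by (simp add: a_def)
      ultimately show ?thesis unfolding b_def cauchy_kernel_i by simp
    qed
    also have "norm \<dots> \<le> norm (z - \<i>) * (norm a * norm b) + 1 / (1 + t^2)"
    proof (rule norm_triangle_le)
      have "norm (\<i> * complex_of_real (1 / (1 + t^2))) = 1 / (1 + t^2)"
        by (simp only: norm_mult norm_ii norm_of_real) simp
      then show "norm ((z - \<i>) * (a * b)) + norm (\<i> * complex_of_real (1 / (1 + t^2)))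
          \<le> norm (z - \<i>) * (norm a * norm b) + 1 / (1 + t^2)"
        by (simp add: norm_mult)
    qed
    also have "norm a * norm b \<le> norm a ^ 2 + norm b ^ 2"
    proof -
      have "0 \<le> norm a * norm b" by simp
      moreover have "2 * (norm a * norm b) \<le> norm a ^ 2 + norm b ^ 2"
        using sum_squares_bound[of "norm a" "norm b"] by simp
      ultimately show ?thesis by linarith
    qed
    also have "1 / (1 + t^2) = norm b ^ 2"
      by (simp add: b_def norm_divide power_divide cmod_power2 add.commute)
    also have "norm (z - \<i>) * (norm a ^ 2 + norm b ^ 2) + norm b ^ 2 \<le> (norm (z - \<i>) + 1) * (norm a ^ 2 + norm b ^ 2)"
      by (simp add: algebra_simps)
    finally show ?thesis by (simp add: a_def b_def norm_divide power_divide mult_left_mono)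
  qed
  then show "AE t in lborel. norm (?k t) \<le> norm ((norm (z - \<i>) + 1) * (1 / (norm (of_real t - z))^2 + 1 / (norm (of_real t - \<i>))^2))"
    by (auto intro!: AE_I2 order_trans[OF _ abs_ge_self])
qed measurable

lemma open_upper: "open {z. Im z > 0}"
  by (simp add: open_halfspace_Im_gt)

lemma isCont_Complex_x: "isCont (\<lambda>x. Complex x y) x"
  unfolding Complex_eq by (intro continuous_intros)

context bounded_borel
begin

text \<open>For merely bounded \<open>w\<close> the kernel 1 / (t - z) is not integrable at
  infinity. The real correction t / (1 + t^2) restores convergence, and after division by pi i it is
  purely imaginary, so the real part remains the Poisson extension. It also makes the value at i
  real.\<close>

definition cauchy :: "complex \<Rightarrow> complex" where
  "cauchy z = (LINT t|lborel. of_real (w t) * (1 / (of_real t - z) - of_real (t / (1 + t^2)))) / (of_real pi * \<i>)"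

definition cauchy' :: "complex \<Rightarrow> complex" where
  "cauchy' z = (LINT t|lborel. of_real (w t) / (of_real t - z)^2) / (of_real pi * \<i>)"

lemma cauchy'_integrable:
  assumes "Im z > 0" shows "integrable lborel (\<lambda>t. of_real (w t) / (of_real t - z)^2)"
  by (rule Bochner_Integration.integrable_bound[OF integrable_mult_right[OF cauchy_kernel_sq_integrable[OF assms], of M]])
    (use bound_w M_nonneg in \<open>auto simp: norm_divide norm_power intro!: divide_right_mono\<close>)

lemma cauchy_integrable:
  assumes "Im z > 0"
  shows "integrable lborel (\<lambda>t. of_real (w t) * (1 / (of_real t - z) - of_real (t / (1 + t^2))))"
  by (rule Bochner_Integration.integrable_bound[OF integrable_mult_right[OF integrable_norm[OF cauchy_kernel_integrable[OF assms]], of M]])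
    (use bound_w M_nonneg in \<open>auto simp: norm_mult abs_mult intro!: mult_right_mono\<close>)

lemma Re_cauchy:
  assumes y: "y > 0" shows "Re (cauchy (Complex x y)) = ext x y"
proof -
  have "Re (cauchy (Complex x y)) = Im (LINT t|lborel. of_real (w t) * (1 / (of_real t - Complex x y) - of_real (t / (1 + t^2)))) / pi"
    by (simp add: cauchy_def Re_divide power2_eq_square)
  also have "\<dots> = (LINT t|lborel. Im (of_real (w t) * (1 / (of_real t - Complex x y) - of_real (t / (1 + t^2))))) / pi"
    using cauchy_integrable[of "Complex x y"] y by (subst integral_Im) simp_all
  also have "\<dots> = (LINT t|lborel. poisson y (t - x) * w t)"
    unfolding integral_divide_zero[symmetric] using y
    by (intro Bochner_Integration.integral_cong) (auto simp: Im_divide poisson_def mult.commute)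
  finally show ?thesis using y by (simp add: ext_def)
qed

lemma cauchy_deriv:
  assumes z: "Im z > 0" shows "(cauchy has_field_derivative cauchy' z) (at z)"
proof (rule has_field_derivativeI_quadratic)
  \<comment> \<open>Increments below half the height keep z + h above height Im z / 2, which bounds
    one Cauchy factor of the remainder by 2 / Im z.\<close>
  show "Im z / 2 > 0" using z by simp
  fix h :: complex assume h: "norm h < Im z / 2"
  then have im: "Im (z + h) > Im z / 2" using abs_Im_le_cmod[of h] by simp
  with z have zh: "Im (z + h) > 0" by simp
  \<comment> \<open>The exact first-order Taylor remainder of 1 / (t - z) in z. Two of its three
    factors form the integrable kernel 1 / |t - z|^2.\<close>
  define r where "r t = of_real (w t) * (h^2 / ((of_real t - z)^2 * (of_real t - (z + h))))" for t :: real
  have req: "r t = of_real (w t) * (1 / (of_real t - (z + h)) - of_real (t / (1 + t^2)))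
      - of_real (w t) * (1 / (of_real t - z) - of_real (t / (1 + t^2))) - h * (of_real (w t) / (of_real t - z)^2)" for t
  proof -
    define p q :: complex where "p = of_real t - z" and "q = of_real t - (z + h)"
    have nz: "p \<noteq> 0" "q \<noteq> 0" using of_real_neq_upper z zh by (auto simp: p_def q_def)
    have h: "h = p - q" by (simp add: p_def q_def)
    have "1 / q - 1 / p - (p - q) / p^2 = p^2 / (p^2 * q) - p * q / (p^2 * q) - (p - q) * q / (p^2 * q)"
      using nz by (simp add: power2_eq_square)
    then have "(p - q)^2 / (p^2 * q) = 1 / q - 1 / p - (p - q) / p^2"
      unfolding diff_divide_distrib[symmetric] by (simp add: power2_eq_square algebra_simps)
    then have "h^2 / (p^2 * q) = 1 / q - 1 / p - h / p^2" by (simp add: h)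
    then show ?thesis unfolding r_def p_def[symmetric] q_def[symmetric]
      by (simp only:) (simp add: right_diff_distrib mult.commute)
  qed
  have "cauchy (z + h) - cauchy z - h * cauchy' z = (LINT t|lborel. r t) / (of_real pi * \<i>)"
  proof -
    have "(LINT t|lborel. A t - B t - h * D t) = (LINT t|lborel. A t) - (LINT t|lborel. B t) - h * (LINT t|lborel. D t)"
      if "integrable lborel A" "integrable lborel B" "integrable lborel D" for A B D :: "real \<Rightarrow> complex"
      using that by simp
    from this[OF cauchy_integrable[OF zh] cauchy_integrable[OF z] cauchy'_integrable[OF z]]
    show ?thesis unfolding cauchy_def cauchy'_def req times_divide_eq_right diff_divide_distrib[symmetric] by (simp only:)
  qed
  also have "norm \<dots> = norm (LINT t|lborel. r t) / pi"
    by (simp add: norm_divide norm_mult)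
  also have "norm (LINT t|lborel. r t) \<le> (LINT t|lborel. (2 * M / Im z * norm h ^ 2) * (1 / (norm (of_real t - z))^2))"
  proof (rule Bochner_Integration.integral_norm_bound_integral)
    show "integrable lborel r" unfolding req
      by (intro Bochner_Integration.integrable_diff integrable_mult_right cauchy_integrable cauchy'_integrable z zh)
    show "integrable lborel (\<lambda>t. (2 * M / Im z * norm h ^ 2) * (1 / (norm (of_real t - z))^2))"
      by (intro integrable_mult_right cauchy_kernel_sq_integrable z)
    fix t :: real
    have "Im z / 2 \<le> norm (of_real t - (z + h))"
      using abs_Im_le_cmod[of "of_real t - (z + h)"] im z by simp
    then have "1 / norm (of_real t - (z + h)) \<le> 2 / Im z"
      using z frac_le[of 1 1 "Im z / 2" "norm (of_real t - (z + h))"] by simp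
    then have "\<bar>w t\<bar> * (1 / norm (of_real t - (z + h))) * (norm h ^ 2 * (1 / (norm (of_real t - z))^2))
       \<le> M * (2 / Im z) * (norm h ^ 2 * (1 / (norm (of_real t - z))^2))"
      using bound_w M_nonneg z by (intro mult_right_mono mult_mono) auto
    also have "\<bar>w t\<bar> * (1 / norm (of_real t - (z + h))) * (norm h ^ 2 * (1 / (norm (of_real t - z))^2)) = norm (r t)"
      unfolding r_def norm_mult norm_divide norm_power by simp
    also have "M * (2 / Im z) * (norm h ^ 2 * (1 / (norm (of_real t - z))^2))
      = (2 * M / Im z * norm h ^ 2) * (1 / (norm (of_real t - z))^2)" by simp
    finally show "norm (r t) \<le> (2 * M / Im z * norm h ^ 2) * (1 / (norm (of_real t - z))^2)" .
  qed
  also have "\<dots> = (2 * M / Im z * norm h ^ 2) * (pi / Im z)"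
    unfolding integral_mult_right_zero cauchy_kernel_sq_integral[OF z] ..
  finally show "norm (cauchy (z + h) - cauchy z - h * cauchy' z) \<le> (2 * M / (Im z)^2) * norm h ^ 2"
    by (simp add: divide_right_mono field_simps power2_eq_square)
qed

lemma cauchy'_bound:
  assumes z: "Im z > 0" shows "norm (cauchy' z) \<le> M / Im z"
proof -
  have "norm (cauchy' z) = norm (LINT t|lborel. of_real (w t) / (of_real t - z)^2) / pi"
    by (simp add: cauchy'_def norm_divide norm_mult)
  also have "norm (LINT t|lborel. of_real (w t) / (of_real t - z)^2) \<le> (LINT t|lborel. M * (1 / (norm (of_real t - z))^2))"
  proof (rule order_trans[OF integral_norm_bound integral_mono])
    show "integrable lborel (\<lambda>t. norm (of_real (w t) / (of_real t - z)^2))"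
      by (intro integrable_norm cauchy'_integrable z)
    show "integrable lborel (\<lambda>t. M * (1 / (norm (of_real t - z))^2))"
      by (intro integrable_mult_right cauchy_kernel_sq_integrable z)
  qed (use cauchy'_integrable[OF z] bound_w in \<open>auto simp: norm_divide norm_power intro!: divide_right_mono\<close>)
  also have "\<dots> = M * (pi / Im z)"
    unfolding integral_mult_right_zero cauchy_kernel_sq_integral[OF z] ..
  finally show ?thesis by (simp add: divide_right_mono)
qed

lemma cauchy_holomorphic: "cauchy holomorphic_on {z. Im z > 0}"
  using cauchy_deriv open_upper by (auto simp: holomorphic_on_open)

lemma cauchy'_holomorphic: "cauchy' holomorphic_on {z. Im z > 0}"
  by (rule holomorphic_transform[OF holomorphic_deriv[OF cauchy_holomorphic open_upper]])
    (use cauchy_deriv DERIV_imp_deriv in auto)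

text \<open>The y-derivative of Re F(x + i y) is Re (i F'), which is - Im F'.\<close>

definition ext_dy :: "real \<Rightarrow> real \<Rightarrow> real" where
  "ext_dy x y = - Im (cauchy' (Complex x y))"

lemma ext_dy_bound: "y > 0 \<Longrightarrow> \<bar>ext_dy x y\<bar> \<le> M / y"
  using order_trans[OF abs_Im_le_cmod cauchy'_bound[of "Complex x y"]] by (simp add: ext_dy_def)

lemma ext_has_dy:
  assumes y: "y > 0" shows "((\<lambda>y. ext x y) has_real_derivative ext_dy x y) (at y)"
proof -
  have c: "((\<lambda>y. Complex x y) has_vector_derivative \<i>) (at y)"
    unfolding Complex_eq by (auto intro!: derivative_eq_intros)
  have "((\<lambda>y. cauchy (Complex x y)) has_vector_derivative \<i> * cauchy' (Complex x y)) (at y)"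
    using field_vector_diff_chain_at[OF c] cauchy_deriv[of "Complex x y"] y by (simp add: o_def)
  then have "((\<lambda>y. Re (cauchy (Complex x y))) has_vector_derivative Re (\<i> * cauchy' (Complex x y))) (at y)"
    by (rule bounded_linear.has_vector_derivative[OF bounded_linear_Re])
  then have "((\<lambda>y. Re (cauchy (Complex x y))) has_real_derivative ext_dy x y) (at y)"
    by (simp add: has_real_derivative_iff_has_vector_derivative ext_dy_def)
  then show ?thesis
    by (rule has_field_derivative_transform_within_open[OF _ open_greaterThan[of 0]]) (use y Re_cauchy in auto)
qed

lemma isCont_ext_x: "y > 0 \<Longrightarrow> isCont (\<lambda>x. ext x y) x"
proof -
  assume y: "y > 0"
  have "isCont (\<lambda>x. Re (cauchy (Complex x y))) x"
    by (rule continuous_Re[OF isCont_o2[OF isCont_Complex_x DERIV_isCont[OF cauchy_deriv]]]) (use y in simp)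
  then show ?thesis using Re_cauchy[OF y] by simp
qed

lemma isCont_ext_dy_x: assumes y: "y > 0" shows "isCont (\<lambda>x. ext_dy x y) x"
proof -
  have "isCont cauchy' (Complex x y)"
    using holomorphic_on_imp_continuous_on[OF cauchy'_holomorphic] open_upper y
    by (auto simp: continuous_on_eq_continuous_at)
  then show ?thesis unfolding ext_dy_def
    by (intro continuous_minus continuous_Im isCont_o2[OF isCont_Complex_x])
qed

text \<open>Provides the constant majorant for height difference quotients in
  \<open>ext_dy_semigroup\<close>.\<close>

lemma ext_lipschitz_y:
  assumes a: "a > 0" and b: "b \<ge> a" shows "\<bar>ext x b - ext x a\<bar> \<le> M / a * (b - a)"
proof -
  have "norm (ext x b - ext x a) \<le> (M / a) * norm (b - a)"
  proof (rule field_differentiable_bound[where S="{a..b}" and f'="ext_dy x"])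
    fix y assume y: "y \<in> {a..b}"
    then show "((\<lambda>y. ext x y) has_field_derivative ext_dy x y) (at y within {a..b})"
      using a ext_has_dy by (auto intro: has_field_derivative_at_within)
    show "norm (ext_dy x y) \<le> M / a"
      using ext_dy_bound[of y x] y a M_nonneg by (auto intro: order_trans[OF _ divide_left_mono])
  qed (use a b in auto)
  then show ?thesis using b by simp
qed

end

section \<open>A generalized Schwarz theorem\<close>

text \<open>Unlike the Poisson kernel, this positive combination has a finite second moment, so that it can
  detect second derivatives; on Poisson extensions it acts as a second difference in height.\<close>

definition kern :: "real \<Rightarrow> real \<Rightarrow> real" where
  "kern h s = 2 * poisson h s - poisson (2 * h) s"

lemma kern_eq:
  assumes "h > 0" shows "kern h s = 6 * h^3 / (pi * (s^2 + h^2) * (s^2 + (2 * h)^2))"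
proof -
  have "s^2 + h^2 > 0" "s^2 + (2 * h)^2 > 0" using assms by (auto intro: add_nonneg_pos)
  moreover have "2 * (h / (pi * p)) - 2 * h / (pi * q) = 2 * h * (q - p) / (pi * p * q)"
    if "p > 0" "q > 0" for p q :: real using that by (simp add: field_simps)
  ultimately show ?thesis by (simp add: kern_def poisson_def power3_eq_cube power2_eq_square)
qed

lemma kern_nonneg: "h > 0 \<Longrightarrow> 0 \<le> kern h s"
  by (simp add: kern_eq)

lemma kern_minus [simp]: "kern h (- s) = kern h s"
  by (simp add: kern_def)

lemma kern_measurable [measurable (raw)]:
  assumes [measurable]: "f \<in> borel_measurable M" "g \<in> borel_measurable M"
  shows "(\<lambda>x. kern (f x) (g x)) \<in> borel_measurable M"
  unfolding kern_def by measurable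

lemma kern_scale: "h > 0 \<Longrightarrow> h * kern h (h * s) = kern 1 s"
proof -
  assume h: "h > 0"
  have "(h * s)^2 + h^2 = h^2 * (s^2 + 1)" "(h * s)^2 + (2 * h)^2 = h^2 * (s^2 + 4)"
    by (simp_all add: algebra_simps power2_eq_square)
  then show ?thesis using h by (simp add: kern_eq power3_eq_cube power2_eq_square)
qed

lemma
  assumes "h > 0"
  shows kern_integrable: "integrable lborel (kern h)"
    and kern_integral: "(LINT s|lborel. kern h s) = 1"
  unfolding kern_def using assms poisson_integrable poisson_integral by auto

text \<open>Multiplication by s^2 leads back to a combination of Poisson kernels, so that the second
  moment is read off from total masses: (4 - 2) h^2.\<close>

lemma kern_square: "h > 0 \<Longrightarrow> kern h s * s^2 = h^2 * (4 * poisson (2 * h) s - 2 * poisson h s)"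
proof -
  assume h: "h > 0"
  have "s^2 + h^2 > 0" "s^2 + (2 * h)^2 > 0" using h by (auto intro: add_nonneg_pos)
  moreover have "4 * (2 * h / (pi * q)) - 2 * (h / (pi * p)) = 2 * h * (4 * p - q) / (pi * p * q)"
    if "p > 0" "q > 0" for p q :: real using that by (simp add: field_simps)
  ultimately show ?thesis using h by (simp add: kern_eq poisson_def power3_eq_cube power2_eq_square)
qed

lemma
  assumes "h > 0"
  shows kern_square_integrable: "integrable lborel (\<lambda>s. kern h s * s^2)"
    and kern_square_integral: "(LINT s|lborel. kern h s * s^2) = 2 * h^2"
  unfolding kern_square[OF assms] using assms poisson_integrable poisson_integral by auto

lemma kern_mult_integrable:
  assumes h: "h > 0" and [measurable]: "f \<in> borel_measurable borel" and le: "\<And>s. \<bar>f s\<bar> \<le> C * (1 + s^2)"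
  shows "integrable lborel (\<lambda>s. kern h s * f s)"
proof (rule Bochner_Integration.integrable_bound)
  show "integrable lborel (\<lambda>s. C * (kern h s + kern h s * s^2))"
    using h by (intro integrable_mult_right Bochner_Integration.integrable_add kern_integrable kern_square_integrable)
  have "\<bar>kern h s * f s\<bar> \<le> C * (kern h s + kern h s * s^2)" for s
    using mult_left_mono[OF le kern_nonneg[OF h], of s s] kern_nonneg[OF h, of s]
    by (simp add: abs_mult algebra_simps)
  then show "AE s in lborel. norm (kern h s * f s) \<le> norm (C * (kern h s + kern h s * s^2))"
    by (auto intro!: AE_I2 order_trans[OF _ abs_ge_self])
qed measurable

text \<open>Substituting h s for s turns the kernel into \<open>kern 1\<close>, while f(h s) / (h
  s)^2 stays below C and tends to L. The factor 2 is the second moment of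
  \<open>kern 1\<close>.\<close>

lemma kern_second_moment_limit:
  assumes [measurable]: "f \<in> borel_measurable borel" and le: "\<And>s. \<bar>f s\<bar> \<le> C * s^2"
    and lim: "((\<lambda>s. f s / s^2) \<longlongrightarrow> L) (at 0)"
  shows "((\<lambda>h. (LINT s|lborel. kern h s * f s) / h^2) \<longlongrightarrow> 2 * L) (at_right 0)"
proof -
  have f0: "f 0 = 0" using le[of 0] by simp
  have "((\<lambda>h. LINT s|lborel. (kern 1 s * s^2) * (f (h * s) / (h * s)^2)) \<longlongrightarrow> (LINT s|lborel. (kern 1 s * s^2) * L)) (at_right 0)"
  proof (rule tendsto_lebesgue_integral_dominated)
    show "integrable lborel (\<lambda>s. (kern 1 s * s^2) * C)" using kern_square_integrable[of 1] by simp
    show "norm ((kern 1 s * s^2) * (f (h * s) / (h * s)^2)) \<le> (kern 1 s * s^2) * C" if "h \<in> {0<..}" for h s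
    proof -
      have "\<bar>f (h * s) / (h * s)^2\<bar> \<le> C" if "s \<noteq> 0"
        using le[of "h * s"] that \<open>h \<in> {0<..}\<close> by (simp add: abs_mult divide_le_eq)
      then show ?thesis using kern_nonneg[of 1 s] by (cases "s = 0") (auto simp: abs_mult simp flip: times_divide_eq_right intro!: mult_left_mono)
    qed
    show "((\<lambda>h. (kern 1 s * s^2) * (f (h * s) / (h * s)^2)) \<longlongrightarrow> (kern 1 s * s^2) * L) (at_right 0)" for s
    proof (cases "s = 0")
      case False
      have "filterlim (\<lambda>h. h * s) (at 0) (at_right 0)"
        using False by (auto simp: filterlim_at eventually_at_filter intro!: tendsto_eq_intros)
      then show ?thesis by (intro tendsto_mult tendsto_const filterlim_compose[OF lim])
    qed simp
  qed measurable
  moreover have "(LINT s|lborel. (kern 1 s * s^2) * (f (h * s) / (h * s)^2)) = (LINT s|lborel. kern h s * f s) / h^2"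
    if h: "h > 0" for h
  proof -
    have "(LINT s|lborel. kern h s * f s) = (LINT s|lborel. kern 1 s * f (h * s))"
      using lborel_integral_real_affine[of h "\<lambda>s. kern h s * f s" 0] h
      by (simp add: kern_scale[OF h, symmetric] mult.assoc)
    also have "\<dots> / h^2 = (LINT s|lborel. kern 1 s * f (h * s) / h^2)" by simp
    also have "\<dots> = (LINT s|lborel. (kern 1 s * s^2) * (f (h * s) / (h * s)^2))"
      by (intro Bochner_Integration.integral_cong) (auto simp: f0 power_mult_distrib)
    finally show ?thesis ..
  qed
  ultimately show ?thesis using kern_square_integral[of 1]
    by (subst tendsto_cong[OF eventually_at_rightI[of 0 1], symmetric]) (auto simp del: times_divide_eq_right)
qed

text \<open>Uses that the kernel is even and has mass 1. The symmetric form is the one for which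
  quadratic bounds in s are available.\<close>

lemma kern_second_difference:
  assumes h: "h > 0" and [measurable]: "f \<in> borel_measurable borel" and le: "\<And>s. \<bar>f s\<bar> \<le> C * (1 + s^2)"
  shows "(LINT s|lborel. kern h s * (f (x + s) + f (x - s) - 2 * f x)) = 2 * ((LINT s|lborel. kern h s * f (x + s)) - f x)"
    and "integrable lborel (\<lambda>s. kern h s * f (x + s))"
proof -
  have C: "C \<ge> 0" using le[of 0] by simp
  have le': "\<bar>f (x + s)\<bar> \<le> (C * (2 + 2 * x^2)) * (1 + s^2)" for s
  proof -
    have "(x + s)^2 \<le> 2 * x^2 + 2 * s^2" using sum_squares_bound[of x s] by (simp add: power2_sum)
    moreover have "0 \<le> s^2 * x^2" by simp
    moreover have "(2 + 2 * x^2) * (1 + s^2) = 2 + 2 * x^2 + 2 * s^2 + 2 * (s^2 * x^2)" by (simp add: algebra_simps)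
    ultimately have "1 + (x + s)^2 \<le> (2 + 2 * x^2) * (1 + s^2)" by linarith
    from mult_left_mono[OF this C] show ?thesis using le[of "x + s"] by (simp add: mult.assoc)
  qed
  show i: "integrable lborel (\<lambda>s. kern h s * f (x + s))"
    by (rule kern_mult_integrable[OF h _ le']) measurable
  have i': "integrable lborel (\<lambda>s. kern h s * f (x - s))"
    using le'[of "- s" for s] by (intro kern_mult_integrable[OF h]) auto
  have e: "(LINT s|lborel. kern h s * f (x - s)) = (LINT s|lborel. kern h s * f (x + s))"
    using lborel_integral_real_affine[of "-1" "\<lambda>s. kern h s * f (x + s)" 0] by simp
  have "(LINT s|lborel. kern h s * (f (x + s) + f (x - s) - 2 * f x))
    = (LINT s|lborel. kern h s * f (x + s) + kern h s * f (x - s) - (2 * f x) * kern h s)"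
    by (simp add: algebra_simps)
  also have "\<dots> = 2 * ((LINT s|lborel. kern h s * f (x + s)) - f x)"
    using i i' e kern_integral[OF h] kern_integrable[OF h] by simp
  finally show "(LINT s|lborel. kern h s * (f (x + s) + f (x - s) - 2 * f x)) = 2 * ((LINT s|lborel. kern h s * f (x + s)) - f x)" .
qed

text \<open>Schwarz's argument. If f exceeds its chord somewhere, it still does after subtraction of
  a small concave parabola, and the difference has an interior maximum. There the second difference
  of f is at most - 2 k s^2 for small s, which forces the limit of the means to be negative.\<close>

lemma below_chord_of_kern_limit:
  fixes f :: "real \<Rightarrow> real"
  assumes cont: "continuous_on UNIV f" and le: "\<And>s. \<bar>f s\<bar> \<le> C * (1 + s^2)"
    and lim: "\<And>x. ((\<lambda>h. ((LINT s|lborel. kern h s * f (x + s)) - f x) / h^2) \<longlongrightarrow> 0) (at_right 0)"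
    and ab: "a < c" "c < b"
  shows "f c \<le> f a + (f b - f a) / (b - a) * (c - a)"
proof (rule ccontr)
  define m where "m = (f b - f a) / (b - a)"
  define l where "l x = f a + m * (x - a)" for x
  assume "\<not> ?thesis"
  then have d: "f c - l c > 0" by (simp add: l_def m_def)
  have [measurable]: "f \<in> borel_measurable borel" using cont by (rule borel_measurable_continuous_onI)
  have C: "C \<ge> 0" using le[of 0] by simp
  \<comment> \<open>Chosen so that the parabola takes away exactly half of the excess of f over the
    chord at c.\<close>
  define k where "k = (f c - l c) / (2 * ((c - a) * (b - c)))"
  have k: "k > 0" using d ab by (simp add: k_def)
  define g where "g x = f x - l x - k * ((x - a) * (b - x))" for x
  have g: "continuous_on {a..b} g" unfolding g_def l_def
    by (intro continuous_intros continuous_on_subset[OF cont]) (use ab in auto)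
  obtain x where x: "x \<in> {a..b}" and max: "\<And>y. y \<in> {a..b} \<Longrightarrow> g y \<le> g x"
    using continuous_attains_sup[OF _ _ g] ab by auto
  have "k * ((c - a) * (b - c)) = (f c - l c) / 2" using ab by (simp add: k_def)
  then have "g c > 0" using d by (simp add: g_def)
  moreover have "g a = 0" "g b = 0" using ab by (auto simp: g_def l_def m_def)
  ultimately have x: "a < x" "x < b" using max[of c] ab x by (auto simp: less_le)
  define \<delta> where "\<delta> = min (x - a) (b - x)"
  have \<delta>: "\<delta> > 0" using x by (simp add: \<delta>_def)
  define \<phi> where "\<phi> s = f (x + s) + f (x - s) - 2 * f x" for s
  \<comment> \<open>A collects the part of the growth bound for the second difference that is
    constant in s. Since s^2 / \<delta>^2 is at least 1 away from the maximum, A can be absorbed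
    there into K s^2.\<close>
  define A where "A = 4 * C + 4 * C * x^2 + 2 * \<bar>f x\<bar>"
  define K where "K = A / \<delta>^2 + 4 * C"
  have K: "K \<ge> 0" using C by (auto simp: K_def A_def intro!: add_nonneg_nonneg divide_nonneg_nonneg)
  \<comment> \<open>A global majorant of the second difference with the correct curvature at 0. The
    far part does not influence the limit of the means, as only the behaviour at 0 does, but it
    makes the majorant quadratic everywhere.\<close>
  define \<psi> where "\<psi> s = (if \<bar>s\<bar> < \<delta> then - 2 * k * s^2 else K * s^2)" for s
  have le1: "\<phi> s \<le> \<psi> s" for s
  proof (cases "\<bar>s\<bar> < \<delta>")
    case True
    then have "x + s \<in> {a..b}" "x - s \<in> {a..b}" unfolding \<delta>_def by auto
    from max[OF this(1)] max[OF this(2)] have "g (x + s) + g (x - s) - 2 * g x \<le> 0" by simp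
    moreover have "g (x + s) + g (x - s) - 2 * g x = \<phi> s + 2 * k * s^2"
      unfolding g_def \<phi>_def l_def by (simp add: algebra_simps power2_eq_square)
    ultimately show ?thesis using True by (simp add: \<psi>_def)
  next
    case False
    then have "\<delta>^2 \<le> s^2" using \<delta> by (metis abs_le_square_iff abs_of_pos linorder_not_less)
    then have s: "1 \<le> s^2 / \<delta>^2" using \<delta> by simp
    have q: "\<bar>f (x + t)\<bar> \<le> C * (1 + 2 * x^2 + 2 * t^2)" for t
      using le[of "x + t"] sum_squares_bound[of x t] C
      by (intro order_trans[OF le] mult_left_mono) (auto simp: power2_sum)
    have "\<phi> s \<le> \<bar>f (x + s)\<bar> + \<bar>f (x + - s)\<bar> + 2 * \<bar>f x\<bar>" unfolding \<phi>_def by simp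
    also have "\<dots> \<le> C * (1 + 2 * x^2 + 2 * s^2) + C * (1 + 2 * x^2 + 2 * (- s)^2) + 2 * \<bar>f x\<bar>"
      by (intro add_mono q order_refl)
    also have "\<dots> \<le> A * 1 + 4 * C * s^2"
      using C by (simp add: A_def algebra_simps)
    also have "\<dots> \<le> A * (s^2 / \<delta>^2) + 4 * C * s^2"
      using s C by (intro add_mono mult_left_mono) (auto simp: A_def)
    also have "\<dots> = \<psi> s" using False by (simp add: \<psi>_def K_def algebra_simps)
    finally show ?thesis .
  qed
  have [measurable]: "\<psi> \<in> borel_measurable borel" "\<phi> \<in> borel_measurable borel"
    unfolding \<psi>_def \<phi>_def by measurable
  have \<psi>le: "\<bar>\<psi> s\<bar> \<le> (2 * k + K) * s^2" for s
    using k K by (auto simp: \<psi>_def abs_mult intro!: mult_right_mono)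
  have "((\<lambda>h. (LINT s|lborel. kern h s * \<psi> s) / h^2) \<longlongrightarrow> 2 * (- 2 * k)) (at_right 0)"
  proof (rule kern_second_moment_limit[OF _ \<psi>le])
    have "eventually (\<lambda>s. - 2 * k = \<psi> s / s^2) (at 0)"
      unfolding eventually_at using \<delta> by (intro exI[of _ \<delta>]) (auto simp: \<psi>_def dist_real_def)
    then show "((\<lambda>s. \<psi> s / s^2) \<longlongrightarrow> - 2 * k) (at 0)"
      by (rule Lim_transform_eventually[OF tendsto_const])
  qed measurable
  moreover have "((\<lambda>h. 2 * (((LINT s|lborel. kern h s * f (x + s)) - f x) / h^2)) \<longlongrightarrow> 2 * 0) (at_right 0)"
    by (intro tendsto_mult tendsto_const lim)
  moreover have "eventually (\<lambda>h. 2 * (((LINT s|lborel. kern h s * f (x + s)) - f x) / h^2)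
      \<le> (LINT s|lborel. kern h s * \<psi> s) / h^2) (at_right 0)"
  proof (rule eventually_at_rightI[of 0 1])
    fix h :: real assume "h \<in> {0<..<1}"
    then have h: "h > 0" by simp
    note kd = kern_second_difference[OF h _ le, of x, OF \<open>f \<in> borel_measurable borel\<close>]
    have "2 * ((LINT s|lborel. kern h s * f (x + s)) - f x) = (LINT s|lborel. kern h s * \<phi> s)"
      unfolding \<phi>_def kd(1) ..
    also have "\<dots> \<le> (LINT s|lborel. kern h s * \<psi> s)"
    proof (rule integral_mono)
      have "integrable lborel (\<lambda>s. kern h s * f (x - s))"
        using lborel_integrable_real_affine[OF kd(2), of "-1" 0] by simp
      then have "integrable lborel (\<lambda>s. kern h s * f (x + s) + kern h s * f (x - s) - (2 * f x) * kern h s)"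
        using kd(2) kern_integrable[OF h] by auto
      then show "integrable lborel (\<lambda>s. kern h s * \<phi> s)" by (simp add: \<phi>_def algebra_simps)
      have "\<bar>\<psi> s\<bar> \<le> (2 * k + K) * (1 + s^2)" for s
        using \<psi>le[of s] k K by (auto simp: algebra_simps intro: order_trans)
      then show "integrable lborel (\<lambda>s. kern h s * \<psi> s)"
        by (intro kern_mult_integrable[OF h]) auto
    qed (use le1 kern_nonneg[OF h] in \<open>auto intro: mult_left_mono\<close>)
    finally show "2 * (((LINT s|lborel. kern h s * f (x + s)) - f x) / h^2) \<le> (LINT s|lborel. kern h s * \<psi> s) / h^2"
      by (simp add: divide_right_mono)
  qed simp
  ultimately have "2 * 0 \<le> 2 * (- 2 * k)" by (rule tendsto_le[OF trivial_limit_at_right_real])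
  then show False using k by simp
qed

lemma affine_of_kern_limit:
  fixes f :: "real \<Rightarrow> real"
  assumes cont: "continuous_on UNIV f" and le: "\<And>s. \<bar>f s\<bar> \<le> C * (1 + s^2)"
    and lim: "\<And>x. ((\<lambda>h. ((LINT s|lborel. kern h s * f (x + s)) - f x) / h^2) \<longlongrightarrow> 0) (at_right 0)"
  shows "\<exists>m b. \<forall>x. f x = m * x + b"
proof -
  have chord: "f c = f a + (f b - f a) / (b - a) * (c - a)" if "a < c" "c < b" for a b c
  proof (rule antisym)
    show "f c \<le> f a + (f b - f a) / (b - a) * (c - a)"
      by (rule below_chord_of_kern_limit[OF cont le lim that])
    have "- f c \<le> - f a + (- f b - - f a) / (b - a) * (c - a)"
    proof (rule below_chord_of_kern_limit[where C=C, OF _ _ _ that])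
      show "((\<lambda>h. ((LINT s|lborel. kern h s * - f (x + s)) - - f x) / h^2) \<longlongrightarrow> 0) (at_right 0)" for x
        using tendsto_minus[OF lim[of x]] by (simp add: minus_divide_left)
    qed (use cont le in \<open>auto intro: continuous_intros\<close>)
    also have "\<dots> = - (f a + (f b - f a) / (b - a) * (c - a))"
      by (simp add: algebra_simps diff_divide_distrib)
    finally show "f a + (f b - f a) / (b - a) * (c - a) \<le> f c" by simp
  qed
  have "f x = (f 1 - f 0) * x + f 0" for x
  proof -
    \<comment> \<open>One interval with 0, 1 and x strictly inside, so that the line over it is
      already determined by the values at 0 and 1.\<close>
    define N where "N = \<bar>x\<bar> + 2"
    define m b where "m = (f N - f (- N)) / (N - - N)" and "b = f (-N) - m * - N"
    have "f c = m * c + b" if "- N < c" "c < N" for c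
      using chord[OF that] unfolding m_def[symmetric] b_def by (simp add: algebra_simps)
    from this[of x] this[of 0] this[of 1] show ?thesis by (simp add: N_def)
  qed
  then show ?thesis by blast
qed

section \<open>Principal values and normal derivatives\<close>

lemma integrable_real_bound:
  fixes f g :: "'a \<Rightarrow> real"
  assumes "integrable M g" "f \<in> borel_measurable M" "\<And>x. \<bar>f x\<bar> \<le> g x" shows "integrable M f"
  by (rule Bochner_Integration.integrable_bound[OF assms(1,2)]) (auto intro!: AE_I2 order_trans[OF assms(3)])

lemma tail_integrable:
  assumes a: "a > 0" shows "integrable lborel (\<lambda>r::real. indicator {r. a < \<bar>r\<bar>} r / r^2 :: real)"
proof (rule Bochner_Integration.integrable_bound)
  show "integrable lborel (\<lambda>r. (1 + 1 / a^2) * pi * poisson 1 r)"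
    by (intro integrable_mult_right poisson_integrable) simp
  have "indicator {r. a < \<bar>r\<bar>} r / r^2 \<le> (1 + 1 / a^2) * pi * poisson 1 r" for r
  proof (cases "a < \<bar>r\<bar>")
    case True
    then have r: "r^2 > 0" "a^2 \<le> r^2" using a by (auto simp flip: abs_le_square_iff)
    have "1 / r^2 = (1 + 1 / r^2) * (1 / (r^2 + 1))"
      using r sum_squares_pos[of 1 r] by (simp add: field_simps)
    also have "\<dots> \<le> (1 + 1 / a^2) * (1 / (r^2 + 1))"
      using r a by (intro mult_right_mono add_left_mono divide_left_mono) auto
    finally have "1 / r^2 \<le> (1 + 1 / a^2) * (1 / (r^2 + 1))" .
    then show ?thesis using True by (simp add: poisson_def)
  qed (simp add: poisson_nonneg)
  then show "AE r in lborel. norm (indicator {r. a < \<bar>r\<bar>} r / r^2) \<le> norm ((1 + 1 / a^2) * pi * poisson 1 r)"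
    by (auto intro!: AE_I2 order_trans[OF _ abs_ge_self])
qed measurable

text \<open>The number 2, kept symbolic: the estimates involve it through the scaling
  \<open>tail / a\<close> and its sign.\<close>

definition tail :: real where "tail = (LINT r|lborel. indicator {r. 1 < \<bar>r\<bar>} r / r^2)"

lemma tail_integral:
  assumes a: "a > 0" shows "(LINT r|lborel. indicator {r. a < \<bar>r\<bar>} r / r^2) = tail / a"
proof -
  have "(LINT r|lborel. indicator {r. a < \<bar>r\<bar>} r / r^2) = a * (LINT r|lborel. indicator {r. a < \<bar>r\<bar>} (a * r) / (a * r)^2)"
    using lborel_integral_real_affine[of a "\<lambda>r. indicator {r. a < \<bar>r\<bar>} r / r^2 :: real" 0] a by simp
  also have "(\<lambda>r. indicator {r. a < \<bar>r\<bar>} (a * r) / (a * r)^2 :: real) = (\<lambda>r. (1 / a^2) * (indicator {r. 1 < \<bar>r\<bar>} r / r^2))"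
    using a by (auto simp: fun_eq_iff indicator_def abs_mult power_mult_distrib)
  finally show ?thesis unfolding tail_def integral_mult_right_zero using a by (simp add: power2_eq_square[of a])
qed

lemma tail_nonneg: "tail \<ge> 0"
  unfolding tail_def by (rule integral_nonneg_AE) auto

lemma has_derivative_quadratic_0:
  fixes f :: "real \<Rightarrow> real"
  assumes "\<And>h. \<bar>f h\<bar> \<le> C * h^2" shows "(f has_real_derivative 0) (at 0)"
  using assms[of 0] by (intro has_field_derivativeI_quadratic[of 1 _ _ _ C]) (use assms in auto)

text \<open>A probability density with distribution function b^2 / (b^2 + 1) on the positive
  half-line. Cutting with \<open>max 0\<close> keeps it continuous on the whole line, as the
  fundamental theorem above requires. It is the weight with which the Poisson kernel averages the
  truncations.\<close>

lemma
  shows layer_integrable: "integrable lborel (\<lambda>b::real. max 0 (2 * b / (b^2 + 1)^2))"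
    and layer_integral: "(LINT b|lborel. max 0 (2 * b / (b^2 + 1)^2 :: real)) = 1"
proof -
  define F :: "real \<Rightarrow> real" where "F b = (if b \<le> 0 then 0 else b^2 / (b^2 + 1))" for b
  have nz: "b^2 + 1 \<noteq> 0" for b :: real using sum_squares_pos[of 1 b] by simp
  have d: "(F has_real_derivative max 0 (2 * b / (b^2 + 1)^2)) (at b)" for b
  proof (cases b "0 :: real" rule: linorder_cases)
    case less
    then have "max 0 (2 * b / (b^2 + 1)^2) = 0" by (auto intro!: max_absorb1 divide_nonpos_nonneg)
    moreover have "((\<lambda>_. 0) has_real_derivative 0) (at b)" by simp
    then have "(F has_real_derivative 0) (at b)"
      by (rule has_field_derivative_transform_within_open[where S="{..<0}"]) (use less in \<open>auto simp: F_def\<close>)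
    ultimately show ?thesis by simp
  next
    case equal
    have "\<bar>F h\<bar> \<le> 1 * h^2" for h
    proof -
      have "h^2 / (h^2 + 1) \<le> h^2 / 1" by (intro divide_left_mono) (auto intro: add_nonneg_pos)
      then show ?thesis by (auto simp: F_def)
    qed
    then show ?thesis using has_derivative_quadratic_0[of F 1] equal by simp
  next
    case greater
    have "((\<lambda>b. b^2 / (b^2 + 1)) has_real_derivative (2 * b / (b^2 + 1)^2)) (at b)"
      using nz[of b] by (auto intro!: derivative_eq_intros simp: power2_eq_square algebra_simps)
    then have "(F has_real_derivative (2 * b / (b^2 + 1)^2)) (at b)"
      by (rule has_field_derivative_transform_within_open[where S="{0<..}"]) (use greater in \<open>auto simp: F_def\<close>)
    then show ?thesis using greater by simp
  qed
  have c: "isCont (\<lambda>b. max 0 (2 * b / (b^2 + 1)^2)) b" for b :: real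
    using nz by (intro continuous_intros) auto
  have bot: "(F \<longlongrightarrow> 0) at_bot"
    by (rule Lim_transform_eventually[OF tendsto_const])
      (auto simp: F_def intro: eventually_mono[OF eventually_le_at_bot[of 0]])
  have "((\<lambda>b::real. b^2 / (b^2 + 1)) \<longlongrightarrow> 1) at_top" by real_asymp
  then have top: "(F \<longlongrightarrow> 1) at_top"
    by (rule Lim_transform_eventually) (auto simp: F_def intro: eventually_mono[OF eventually_gt_at_top[of 0]])
  show "integrable lborel (\<lambda>b::real. max 0 (2 * b / (b^2 + 1)^2))" "(LINT b|lborel. max 0 (2 * b / (b^2 + 1)^2 :: real)) = 1"
    using lborel_integral_FTC_nonneg[OF d c _ bot top] by auto
qed

text \<open>The tent of half-width t: integrating a second derivative against it gives the symmetric
  second difference with step t (\<open>dbl_second_difference\<close>).\<close>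

definition tri :: "real \<Rightarrow> real \<Rightarrow> real" where "tri t r = max 0 (t - \<bar>r\<bar>)"

lemma tri_measurable [measurable (raw)]:
  assumes [measurable]: "f \<in> borel_measurable M" "g \<in> borel_measurable M"
  shows "(\<lambda>x. tri (f x) (g x)) \<in> borel_measurable M"
  unfolding tri_def by measurable

lemma layer_measurable [measurable]:
  fixes k :: "real \<Rightarrow> real"
  assumes [measurable]: "k \<in> borel_measurable borel"
  shows "(\<lambda>r. LINT a|lborel. indicator {0<..<\<bar>r\<bar>} a * k a :: real) \<in> borel_measurable borel"
  unfolding indicator_def greaterThanLessThan_iff by measurable

lemma integral_open_interval:
  assumes R: "0 \<le> (R::real)" and F: "\<And>a. (F has_real_derivative k a) (at a)" and k: "\<And>a. isCont k a"
  shows "(LINT a|lborel. indicator {0<..<R} a * k a) = F R - F 0"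
proof -
  have [measurable]: "k \<in> borel_measurable borel"
    using k by (intro borel_measurable_continuous_onI) (simp add: continuous_on_eq_continuous_at)
  have "AE a in lborel. a \<noteq> 0 \<and> a \<noteq> R"
    using AE_lborel_singleton[of "0::real"] AE_lborel_singleton[of R] by eventually_elim simp
  then have "(LINT a|lborel. indicator {0<..<R} a * k a) = (LINT a|lborel. k a * indicator {0..R} a)"
    by (intro integral_cong_AE) (auto simp: indicator_def)
  also have "\<dots> = F R - F 0"
    using R F k by (intro integral_FTC_Icc_real) (auto intro: has_field_derivative_at_within)
  finally show ?thesis .
qed

context bounded_borel
begin

text \<open>The principal value integral cut off at distance a, in the variable r = y - x and
  without the factor 1 / pi; a half-Laplacian L thus appears as the limit pi L.\<close>

definition trunc :: "real \<Rightarrow> real \<Rightarrow> real" where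
  "trunc x a = (LINT r|lborel. indicator {r. a < \<bar>r\<bar>} r * ((w x - w (x + r)) / r^2))"

lemma trunc_measurable [measurable]: "trunc x \<in> borel_measurable borel"
  unfolding trunc_def by measurable

lemma diff_bound: "\<bar>w x - w y\<bar> \<le> 2 * M"
  using bound_w[of x] bound_w[of y] by linarith

lemma trunc_integrand_bound:
  "\<bar>indicator {r. a < \<bar>r\<bar>} r * ((w x - w (x + r)) / r^2)\<bar> \<le> 2 * M * (indicator {r. a < \<bar>r\<bar>} r / r^2)"
  using diff_bound[of x "x + r"] by (auto simp: abs_mult indicator_def intro!: divide_right_mono)

lemma trunc_bound: assumes a: "a > 0" shows "\<bar>trunc x a\<bar> \<le> 2 * M * tail / a"
proof -
  have "\<bar>trunc x a\<bar> \<le> (LINT r|lborel. 2 * M * (indicator {r. a < \<bar>r\<bar>} r / r^2))"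
    unfolding trunc_def
  proof (rule integral_abs_bound_integral)
    show "integrable lborel (\<lambda>r. 2 * M * (indicator {r. a < \<bar>r\<bar>} r / r^2))"
      by (intro integrable_mult_right tail_integrable a)
    then show "integrable lborel (\<lambda>r. indicator {r. a < \<bar>r\<bar>} r * ((w x - w (x + r)) / r^2))"
      by (rule integrable_real_bound) (measurable, rule trunc_integrand_bound)
  qed (rule trunc_integrand_bound)
  then show ?thesis using tail_integral[OF a] by (simp only: integral_mult_right_zero) simp
qed

text \<open>Convergence controls small a and the tail estimate controls the rest. The bound depends
  on x.\<close>

lemma trunc_bounded:
  assumes lim: "(trunc x \<longlongrightarrow> L) (at_right 0)"
  shows "\<exists>B. \<forall>a>0. \<bar>trunc x a\<bar> \<le> B"
proof -
  have "eventually (\<lambda>a. dist (trunc x a) L < 1) (at_right 0)"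
    using lim by (rule tendstoD) simp
  then obtain d where d: "d > 0" "\<And>a. 0 < a \<Longrightarrow> a < d \<Longrightarrow> dist (trunc x a) L < 1"
    unfolding eventually_at_right_field by auto
  have "\<bar>trunc x a\<bar> \<le> \<bar>L\<bar> + 1 + 2 * M * tail / d" if a: "a > 0" for a
  proof (cases "a < d")
    case True
    have "2 * M * tail / d \<ge> 0" using d M_nonneg tail_nonneg by simp
    with d(2)[OF a True] show ?thesis unfolding dist_real_def by linarith
  next
    case False
    have "2 * M * tail / a \<le> 2 * M * tail / d"
      using False d a M_nonneg tail_nonneg by (intro divide_left_mono) auto
    then show ?thesis using trunc_bound[OF a, of x] by linarith
  qed
  then show ?thesis by blast
qed

text \<open>Kernels of bounded variation are superpositions of the cut-offs defining the principal value;
  only an average of the truncated integrals remains, which makes conditional convergence harmless.\<close>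

lemma layer_cake:
  assumes [measurable]: "k \<in> borel_measurable borel"
    and int: "integrable lborel (\<lambda>a. indicator {0<..} a * (k a / a))"
  shows "(LINT r|lborel. (LINT a|lborel. indicator {0<..<\<bar>r\<bar>} a * k a) * ((w x - w (x + r)) / r^2))
       = (LINT a|lborel. indicator {0<..} a * (k a * trunc x a))"
proof -
  define f where "f a r = indicator {0<..} a * (k a * (indicator {r. a < \<bar>r\<bar>} r * ((w x - w (x + r)) / r^2)))" for a r
  \<comment> \<open>Integrating this majorant over r gives 2 M times \<open>tail\<close> times |k a|
    / a, which is where the integrability hypothesis comes from.\<close>
  define g where "g a r = indicator {0<..} a * (\<bar>k a\<bar> * (2 * M * (indicator {r. a < \<bar>r\<bar>} r / r^2)))" for a r :: real
  have "(LINT a|lborel. LINT r|lborel. f a r) = (LINT r|lborel. LINT a|lborel. f a r)"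
  proof (rule lborel_integral_swap[where g=g])
    show "\<bar>f a r\<bar> \<le> g a r" for a r
      unfolding f_def g_def abs_mult by (intro mult_mono mult_left_mono trunc_integrand_bound[unfolded abs_mult]) auto
    show "integrable lborel (\<lambda>r. g a r)" for a
      unfolding g_def by (cases "a > 0") (auto intro!: integrable_mult_right tail_integrable simp del: times_divide_eq_right)
    have "(LINT r|lborel. g a r) = 2 * M * tail * norm (indicator {0<..} a * (k a / a))" for a
      unfolding g_def integral_mult_right_zero by (cases "a > 0") (auto simp: tail_integral)
    then show "integrable lborel (\<lambda>a. LINT r|lborel. g a r)"
      using integrable_mult_right[OF integrable_norm[OF int]] by simp
  qed (unfold f_def g_def, measurable)
  moreover have "(LINT r|lborel. f a r) = indicator {0<..} a * (k a * trunc x a)" for a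
    unfolding f_def trunc_def integral_mult_right_zero ..
  moreover have "(LINT a|lborel. f a r) = (LINT a|lborel. indicator {0<..<\<bar>r\<bar>} a * k a) * ((w x - w (x + r)) / r^2)" for r
    unfolding integral_mult_left_zero[symmetric] f_def
    by (intro Bochner_Integration.integral_cong) (auto simp: indicator_def)
  ultimately show ?thesis by simp
qed

text \<open>(w x - \<open>ext x y\<close>) / y is 1 / pi times the integral of (w x - w (x + r)) /
  (r^2 + y^2). As r^2 / (r^2 + y^2) is the integral of 2 a y^2 / (a^2 + y^2)^2 over 0 < a < |r|,
  \<open>layer_cake\<close> rewrites this as an average of truncations at cut-offs of size y, and
  the limit passes through the average by domination.\<close>

lemma ext_normal_derivative:
  assumes lim: "(trunc x \<longlongrightarrow> pi * L) (at_right 0)"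
  shows "((\<lambda>y. (ext x y - w x) / y) \<longlongrightarrow> - L) (at_right 0)"
proof -
  obtain B where B: "\<And>a. a > 0 \<Longrightarrow> \<bar>trunc x a\<bar> \<le> B" using trunc_bounded[OF lim] by blast
  define m :: "real \<Rightarrow> real" where "m b = max 0 (2 * b / (b^2 + 1)^2)" for b
  have m0: "m b = 0" if "b \<le> 0" for b using that by (auto simp: m_def intro!: max_absorb1 divide_nonpos_nonneg)
  have mpos: "m b = 2 * b / (b^2 + 1)^2" if "b > 0" for b using that by (auto simp: m_def)
  have mn: "m b \<ge> 0" for b by (simp add: m_def)
  have [measurable]: "m \<in> borel_measurable borel" unfolding m_def by measurable
  have "((\<lambda>y. LINT b|lborel. m b * trunc x (y * b)) \<longlongrightarrow> (LINT b|lborel. m b * (pi * L))) (at_right 0)"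
  proof (rule tendsto_lebesgue_integral_dominated)
    show "integrable lborel (\<lambda>b. m b * B)" unfolding m_def by (intro integrable_mult_left layer_integrable)
    show "norm (m b * trunc x (y * b)) \<le> m b * B" if "y \<in> {0<..}" for y b
      using B[of "y * b"] that m0[of b] by (cases "b > 0") (auto simp: abs_mult mn intro!: mult_left_mono)
    show "((\<lambda>y. m b * trunc x (y * b)) \<longlongrightarrow> m b * (pi * L)) (at_right 0)" for b
    proof (cases "b > 0")
      case True
      have "filterlim (\<lambda>y. y * b) (at_right 0) (at_right 0)"
        using True by (auto simp: filterlim_at eventually_at_filter intro!: tendsto_eq_intros)
      then show ?thesis by (intro tendsto_mult tendsto_const filterlim_compose[OF lim])
    qed (simp add: m0)
  qed measurable
  also have "(LINT b|lborel. m b * (pi * L)) = pi * L" using layer_integral by (simp add: m_def)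
  finally have "((\<lambda>y. - (LINT b|lborel. m b * trunc x (y * b)) / pi) \<longlongrightarrow> - (pi * L) / pi) (at_right 0)"
    by (intro tendsto_intros) auto
  moreover have "- (LINT b|lborel. m b * trunc x (y * b)) / pi = (ext x y - w x) / y" if y: "y > 0" for y
  proof -
    have nz: "a^2 + y^2 \<noteq> 0" for a using y by simp
    define k where "k a = 2 * a * y^2 / (a^2 + y^2)^2" for a
    have "(LINT a|lborel. indicator {0<..} a * (k a * trunc x a)) = y * (LINT b|lborel. indicator {0<..} (y * b) * (k (y * b) * trunc x (y * b)))"
      using lborel_integral_real_affine[of y "\<lambda>a. indicator {0<..} a * (k a * trunc x a)" 0] y by simp
    also have "\<dots> = (LINT b|lborel. m b * trunc x (y * b))"
      unfolding integral_mult_right_zero[symmetric]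
    proof (intro Bochner_Integration.integral_cong refl)
      fix b
      have "(y * b)^2 + y^2 = y^2 * (b^2 + 1)" by (simp add: algebra_simps power2_eq_square)
      then have "y * k (y * b) = 2 * b / (b^2 + 1)^2"
        using y by (simp add: k_def power2_eq_square)
      then show "y * (indicator {0<..} (y * b) * (k (y * b) * trunc x (y * b))) = m b * trunc x (y * b)"
        using y by (cases "b > 0") (auto simp: mpos m0 indicator_def zero_less_mult_iff simp flip: mult.assoc)
    qed
    finally have 1: "(LINT b|lborel. m b * trunc x (y * b)) = (LINT a|lborel. indicator {0<..} a * (k a * trunc x a))" ..
    have kc: "isCont k a" for a unfolding k_def using nz by (intro continuous_intros) auto
    have [measurable]: "k \<in> borel_measurable borel"
      unfolding k_def by measurable
    have kd: "((\<lambda>a. a^2 / (a^2 + y^2)) has_real_derivative k a) (at a)" for a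
      unfolding k_def using y by (auto intro!: derivative_eq_intros simp: nz power2_eq_square algebra_simps)
    have 2: "(LINT a|lborel. indicator {0<..} a * (k a * trunc x a)) =
       (LINT r|lborel. (LINT a|lborel. indicator {0<..<\<bar>r\<bar>} a * k a) * ((w x - w (x + r)) / r^2))"
    proof (rule layer_cake[symmetric])
      show "integrable lborel (\<lambda>a. indicator {0<..} a * (k a / a))"
      proof (rule integrable_real_bound)
        show "integrable lborel (\<lambda>a. (2 * pi / y) * poisson y a)"
          using y by (intro integrable_mult_right poisson_integrable)
        show "\<bar>indicator {0<..} a * (k a / a)\<bar> \<le> (2 * pi / y) * poisson y a" for a
        proof -
          have "y^2 \<le> a^2 + y^2" by simp
          then have "2 * y^2 / (a^2 + y^2)^2 \<le> 2 * (a^2 + y^2) / (a^2 + y^2)^2"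
            by (intro divide_right_mono) auto
          also have "\<dots> = 2 / (a^2 + y^2)"
          proof -
            have "2 * p / p^2 = 2 / p" for p :: real by (simp add: power2_eq_square)
            then show ?thesis .
          qed
          also have "\<dots> = (2 * pi / y) * poisson y a" using y by (simp add: poisson_def)
          finally show ?thesis using y by (auto simp: indicator_def k_def poisson_nonneg)
        qed
      qed measurable
    qed measurable
    also have "\<dots> = (LINT r|lborel. (pi / y) * (w x * poisson y r - poisson y r * w (x + r)))"
    proof (rule integral_cong_AE)
      have "AE r in lborel. r \<noteq> (0::real)" by (rule AE_lborel_singleton)
      then show "AE r in lborel. (LINT a|lborel. indicator {0<..<\<bar>r\<bar>} a * k a) * ((w x - w (x + r)) / r^2)
          = (pi / y) * (w x * poisson y r - poisson y r * w (x + r))"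
      proof eventually_elim
        case (elim r)
        have e: "(LINT a|lborel. indicator {0<..<\<bar>r\<bar>} a * k a) = r^2 / (r^2 + y^2)"
          using integral_open_interval[OF abs_ge_zero kd kc, of r] by simp
        have gen: "q / p * ((A - B) / q) = (pi / y) * (A * (y / (pi * p)) - y / (pi * p) * B)"
          if "p \<noteq> 0" "q \<noteq> 0" for p q A B :: real using that y by (simp add: field_simps)
        have "r^2 \<noteq> 0" using elim by simp
        from gen[OF nz[of r] this] show ?case unfolding e poisson_def .
      qed
    qed measurable
    also have "\<dots> = (pi / y) * (w x - ext x y)"
    proof -
      have "integrable lborel (\<lambda>r. poisson y r * w (x + r))"
        by (rule Bochner_Integration.integrable_bound[OF integrable_mult_right[OF poisson_integrable[OF y], of M]])
          (use bound_w M_nonneg in \<open>auto simp: abs_mult mult.commute[of M] intro!: mult_left_mono\<close>)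
      then show ?thesis using poisson_integrable[OF y] poisson_integral[OF y] by (simp add: ext_shift[OF y])
    qed
    finally show ?thesis unfolding 1 using y by (simp add: field_simps)
  qed
  ultimately show ?thesis
    by (subst tendsto_cong[OF eventually_at_rightI[of 0 1], symmetric]) auto
qed

lemma tri_bound:
  assumes t: "t > 0" and B: "\<And>a. a > 0 \<Longrightarrow> \<bar>trunc x a\<bar> \<le> B"
  shows "\<bar>LINT r|lborel. tri t r * (w x - w (x + r))\<bar> \<le> 5 * B * t^3"
proof -
  \<comment> \<open>The derivative of a^2 (t - a), stopped at a = t. Its primitive at |r| is r^2
    times the tent, as \<open>layer_cake\<close> needs; the 5 below comes from |2 a t - 3 a^2| being
    at most 5 t^2.\<close>
  define k where "k a = indicator {..<t} a * (2 * a * t - 3 * a^2)" for a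
  have [measurable]: "k \<in> borel_measurable borel" unfolding k_def by measurable
  have "(LINT r|lborel. tri t r * (w x - w (x + r)))
      = (LINT r|lborel. (LINT a|lborel. indicator {0<..<\<bar>r\<bar>} a * k a) * ((w x - w (x + r)) / r^2))"
  proof (rule integral_cong_AE)
    have "AE r in lborel. r \<noteq> (0::real)" by (rule AE_lborel_singleton)
    then show "AE r in lborel. tri t r * (w x - w (x + r))
      = (LINT a|lborel. indicator {0<..<\<bar>r\<bar>} a * k a) * ((w x - w (x + r)) / r^2)"
    proof eventually_elim
      case (elim r)
      have "(LINT a|lborel. indicator {0<..<\<bar>r\<bar>} a * k a) = (LINT a|lborel. indicator {0<..<min t \<bar>r\<bar>} a * (2 * a * t - 3 * a^2))"
        by (intro Bochner_Integration.integral_cong) (auto simp: k_def indicator_def)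
      also have "\<dots> = (min t \<bar>r\<bar>)^2 * t - (min t \<bar>r\<bar>)^3 - (0^2 * t - 0^3)"
        by (intro integral_open_interval) (use t in \<open>auto intro!: derivative_eq_intros continuous_intros\<close>)
      also have "\<dots> = tri t r * r^2"
        using t by (auto simp: tri_def min_def max_def power2_eq_square power3_eq_cube algebra_simps)
      finally show ?case using elim by simp
    qed
    show "(\<lambda>r. tri t r * (w x - w (x + r))) \<in> borel_measurable lborel"
      unfolding tri_def by measurable
  qed measurable
  also have "\<dots> = (LINT a|lborel. indicator {0<..} a * (k a * trunc x a))"
  proof (rule layer_cake)
    have "integrable lborel (\<lambda>a. indicator {0..t} a *\<^sub>R (2 * t - 3 * a))"
      by (intro borel_integrable_atLeastAtMost' [unfolded set_integrable_def] continuous_intros)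
    then have "integrable lborel (\<lambda>a. indicator {0<..<t} a * (2 * t - 3 * a))"
      by (rule Bochner_Integration.integrable_bound) (auto simp: indicator_def)
    moreover have "indicator {0<..} a * (k a / a) = indicator {0<..<t} a * (2 * t - 3 * a)" for a
      by (auto simp: k_def indicator_def power2_eq_square field_simps)
    ultimately show "integrable lborel (\<lambda>a. indicator {0<..} a * (k a / a))" by simp
  qed measurable
  also have "\<bar>\<dots>\<bar> \<le> (LINT a|lborel. indicator {0..t} a * (5 * t^2 * B))"
  proof (rule integral_abs_bound_integral)
    show i: "integrable lborel (\<lambda>a. indicator {0..t} a * (5 * t^2 * B))"
      by (intro integrable_mult_left) (use t in \<open>simp add: integrable_indicator_iff\<close>)
    show le: "\<bar>indicator {0<..} a * (k a * trunc x a)\<bar> \<le> indicator {0..t} a * (5 * t^2 * B)" for a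
    proof (cases "0 < a \<and> a < t")
      case True
      then have "a * t \<le> t * t" "a * a \<le> t * t" "0 \<le> a * t" "0 \<le> a * a" by (auto intro: mult_mono)
      then have "\<bar>2 * (a * t) - 3 * (a * a)\<bar> \<le> 5 * (t * t)" by (intro abs_leI) linarith+
      then have "\<bar>2 * a * t - 3 * a^2\<bar> \<le> 5 * t^2" by (simp add: power2_eq_square mult.assoc)
      then show ?thesis using True B[of a] by (auto simp: k_def abs_mult intro!: mult_mono)
    next
      case False
      have "B \<ge> 0" using B[of 1] by simp
      with False show ?thesis by (auto simp: k_def indicator_def)
    qed
    show "integrable lborel (\<lambda>a. indicator {0<..} a * (k a * trunc x a))"
      by (rule integrable_real_bound[OF i _ le]) measurable
  qed
  also have "\<dots> = 5 * B * t^3" using t by (simp add: power2_eq_square power3_eq_cube)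
  finally show ?thesis .
qed

end

section \<open>Second antiderivatives\<close>

lemma tri_nonneg: "0 \<le> tri t r"
  by (simp add: tri_def)

lemma
  assumes t: "t \<ge> 0"
  shows tri_integrable: "integrable lborel (tri t)" and tri_integral: "(LINT r|lborel. tri t r) = t^2"
proof -
  have e: "tri t r = (t - \<bar>r\<bar>) * indicator {-t..t} r" for r
    by (auto simp: tri_def indicator_def)
  have d: "((\<lambda>r. r * \<bar>r\<bar>) has_real_derivative 2 * \<bar>r\<bar>) (at r)" for r :: real
  proof (cases r "0 :: real" rule: linorder_cases)
    case less
    have "((\<lambda>r. - (r^2)) has_real_derivative 2 * \<bar>r\<bar>) (at r)"
      using less by (auto intro!: derivative_eq_intros)
    then show ?thesis
      by (rule has_field_derivative_transform_within_open[where S="{..<0}"]) (use less in \<open>auto simp: power2_eq_square\<close>)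
  next
    case equal
    then show ?thesis using has_derivative_quadratic_0[of "\<lambda>r. r * \<bar>r\<bar>" 1] by (simp add: abs_mult power2_eq_square)
  next
    case greater
    have "((\<lambda>r. r^2) has_real_derivative 2 * \<bar>r\<bar>) (at r)"
      using greater by (auto intro!: derivative_eq_intros)
    then show ?thesis
      by (rule has_field_derivative_transform_within_open[where S="{0<..}"]) (use greater in \<open>auto simp: power2_eq_square\<close>)
  qed
  have F: "((\<lambda>r. t * r - r * \<bar>r\<bar> / 2) has_real_derivative t - \<bar>r\<bar>) (at r)" for r
    using DERIV_diff[OF DERIV_cmult[OF DERIV_ident, of t] DERIV_cdivide[OF d, of 2], of r] by simp
  have "(LINT r|lborel. (t - \<bar>r\<bar>) * indicator {-t..t} r) = (t * t - t * \<bar>t\<bar> / 2) - (t * - t - - t * \<bar>- t\<bar> / 2)"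
    by (rule integral_FTC_Icc_real) (use t F in \<open>auto intro: has_field_derivative_at_within intro!: continuous_intros\<close>)
  then show "(LINT r|lborel. tri t r) = t^2" using t by (simp add: e power2_eq_square)
  have "integrable lborel (\<lambda>r. indicator {-t..t} r *\<^sub>R (t - \<bar>r\<bar>))"
    by (intro borel_integrable_atLeastAtMost'[unfolded set_integrable_def] continuous_intros)
  then show "integrable lborel (tri t)" by (simp add: e[abs_def] mult.commute)
qed

lemma tri_mean_tendsto_0:
  assumes [measurable]: "q \<in> borel_measurable borel" and le: "\<And>r. \<bar>q r\<bar> \<le> Q" and lim: "(q \<longlongrightarrow> 0) (at 0)" and q0: "q 0 = 0"
  shows "((\<lambda>t. (LINT r|lborel. tri t r * q r) / t^2) \<longlongrightarrow> 0) (at_right 0)"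
proof (rule tendstoI)
  fix e :: real assume e: "e > 0"
  obtain d where d: "d > 0" "\<And>r. r \<noteq> 0 \<Longrightarrow> \<bar>r\<bar> < d \<Longrightarrow> \<bar>q r\<bar> < e / 2"
    using tendstoD[OF lim, of "e/2"] e unfolding eventually_at by (auto simp: dist_real_def)
  show "eventually (\<lambda>t. dist ((LINT r|lborel. tri t r * q r) / t^2) 0 < e) (at_right 0)"
  proof (rule eventually_at_rightI[OF _ d(1)])
    fix t assume "t \<in> {0<..<d}"
    then have t: "0 < t" "t < d" by auto
    have le2: "\<bar>tri t r * q r\<bar> \<le> tri t r * (e / 2)" for r
    proof (cases "\<bar>r\<bar> < d")
      case True
      then have "\<bar>q r\<bar> \<le> e / 2" using d(2)[of r] q0 e by (cases "r = 0") auto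
      then show ?thesis using tri_nonneg[of t r] by (simp only: abs_mult) (intro mult_mono; simp)
    next
      case False
      then show ?thesis using t by (simp add: tri_def)
    qed
    have i: "integrable lborel (\<lambda>r. tri t r * (e / 2))" using tri_integrable[of t] t by simp
    have "\<bar>LINT r|lborel. tri t r * q r\<bar> \<le> (LINT r|lborel. tri t r * (e / 2))"
      by (rule integral_abs_bound_integral[OF integrable_real_bound[OF i _ le2] i le2]) measurable
    also have "\<dots> = t^2 * (e / 2)" using tri_integral[of t] t by simp
    finally have "\<bar>(LINT r|lborel. tri t r * q r) / t^2\<bar> \<le> e / 2" using t by (simp add: pos_divide_le_eq mult.commute[of "t^2"])
    then show "dist ((LINT r|lborel. tri t r * q r) / t^2) 0 < e" unfolding dist_real_def diff_0_right using e by linarith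
  qed
qed

text \<open>The kernel of the second antiderivative that vanishes to second order at \<open>0\<close>.\<close>

definition dker :: "real \<Rightarrow> real \<Rightarrow> real" where
  "dker x r = max 0 (x - r) - max 0 (- r) - x * indicator {..<0} r"

definition dbl :: "(real \<Rightarrow> real) \<Rightarrow> real \<Rightarrow> real" where
  "dbl g x = (LINT r|lborel. dker x r * g r)"

text \<open>The kernel lives between 0 and x and equals |x - r| there, which gives
  \<open>dbl\<close> its quadratic growth.\<close>

lemma dker_bound: "\<bar>x\<bar> \<le> R \<Longrightarrow> \<bar>dker x r\<bar> \<le> R * indicator {-R..R} r"
proof -
  assume x: "\<bar>x\<bar> \<le> R"
  have "dker x r = (if r < 0 then max 0 (r - x) else max 0 (x - r))"
    by (simp add: dker_def max_def)
  then have "0 \<le> dker x r" "dker x r \<le> R" "\<not> \<bar>r\<bar> \<le> R \<Longrightarrow> dker x r = 0"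
    using x by (auto split: if_splits)
  then show ?thesis by (cases "\<bar>r\<bar> \<le> R") (auto simp: indicator_def)
qed

lemma dker_measurable [measurable]: "dker x \<in> borel_measurable borel"
  unfolding dker_def by measurable

lemma indicator_Icc_integrable: "integrable lborel (indicator {a..b::real} :: real \<Rightarrow> real)"
  by (cases "a \<le> b") (auto simp: integrable_indicator_iff)

locale bounded_source =
  fixes g :: "real \<Rightarrow> real" and G :: real
  assumes measurable_g [measurable]: "g \<in> borel_measurable borel" and bound_g: "\<bar>g x\<bar> \<le> G"
begin

lemma G_nonneg: "0 \<le> G"
  using bound_g[of 0] by linarith

lemma dker_g_bound: "\<bar>x\<bar> \<le> R \<Longrightarrow> \<bar>dker x r * g r\<bar> \<le> (R * G) * indicator {-R..R} r"
  using mult_mono[OF dker_bound bound_g, of x R r r] by (auto simp: abs_mult mult_ac)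

lemma dker_g_integrable: "integrable lborel (\<lambda>r. dker x r * g r)"
  by (rule integrable_real_bound[OF _ _ dker_g_bound[OF order_refl]])
    (auto intro!: integrable_mult_right indicator_Icc_integrable)

lemma dbl_bound: "\<bar>dbl g x\<bar> \<le> (2 * G) * x^2"
proof -
  have "\<bar>dbl g x\<bar> \<le> (LINT r|lborel. (\<bar>x\<bar> * G) * indicator {-\<bar>x\<bar>..\<bar>x\<bar>} r)"
    unfolding dbl_def
    by (rule integral_abs_bound_integral[OF dker_g_integrable _ dker_g_bound[OF order_refl]])
      (auto intro!: integrable_mult_right indicator_Icc_integrable)
  also have "\<dots> = 2 * G * (\<bar>x\<bar> * \<bar>x\<bar>)" by simp
  finally show ?thesis by (simp add: power2_eq_square)
qed

lemma dbl_continuous: "continuous_on UNIV (dbl g)"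
  unfolding continuous_on_eq_continuous_at[OF open_UNIV]
proof
  fix x :: real
  define S where "S = {x - 1 <..< x + 1}"
  have S: "at x within S = at x" by (rule at_within_open) (auto simp: S_def)
  have "(dbl g \<longlongrightarrow> dbl g x) (at x within S)"
    unfolding dbl_def
  proof (rule tendsto_lebesgue_integral_dominated)
    show "integrable lborel (\<lambda>r. ((\<bar>x\<bar> + 1) * G) * indicator {-(\<bar>x\<bar> + 1)..\<bar>x\<bar> + 1} r)"
      by (auto intro!: integrable_mult_right indicator_Icc_integrable)
    show "norm (dker y r * g r) \<le> ((\<bar>x\<bar> + 1) * G) * indicator {-(\<bar>x\<bar> + 1)..\<bar>x\<bar> + 1} r" if "y \<in> S" for y r
      unfolding real_norm_def using that by (intro dker_g_bound) (auto simp: S_def)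
    show "((\<lambda>y. dker y r * g r) \<longlongrightarrow> dker x r * g r) (at x within S)" for r
      unfolding dker_def by (intro tendsto_intros)
  qed measurable
  then show "isCont (dbl g) x"
    unfolding isCont_def S .
qed

text \<open>The correction terms in \<open>dker\<close> are affine in x and drop out; the second
  difference of a positive part is a tent.\<close>

lemma dbl_second_difference:
  assumes t: "t \<ge> 0" shows "dbl g (x + t) + dbl g (x - t) - 2 * dbl g x = (LINT r|lborel. tri t r * g (x + r))"
proof -
  have "dbl g (x + t) + dbl g (x - t) - 2 * dbl g x
      = (LINT r|lborel. dker (x + t) r * g r + dker (x - t) r * g r - 2 * (dker x r * g r))"
    unfolding dbl_def using dker_g_integrable by simp
  also have "\<dots> = (LINT r|lborel. tri t (r - x) * g r)"
  proof (intro Bochner_Integration.integral_cong refl)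
    fix r
    have "dker (x + t) r + dker (x - t) r - 2 * dker x r = tri t (r - x)"
    proof -
      have "max 0 (t - d) + max 0 (- t - d) - 2 * max 0 (- d) = max 0 (t - \<bar>d\<bar>)" for d
        using t by (simp add: max_def)
      from this[of "r - x"] show ?thesis
        unfolding dker_def tri_def by (simp add: algebra_simps)
    qed
    then show "dker (x + t) r * g r + dker (x - t) r * g r - 2 * (dker x r * g r) = tri t (r - x) * g r"
      by (simp flip: distrib_right left_diff_distrib mult.assoc)
  qed
  also have "\<dots> = (LINT r|lborel. tri t r * g (x + r))"
    using lborel_integral_real_affine[of 1 "\<lambda>r. tri t (r - x) * g r" x] by simp
  finally show ?thesis .
qed

lemma tri_g_bound: "\<bar>tri t r * g (x + r)\<bar> \<le> G * tri t r"
  using mult_left_mono[OF bound_g tri_nonneg, of t r "x + r"] tri_nonneg[of t r] by (simp add: abs_mult mult.commute)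

lemma tri_g_integrable: "t \<ge> 0 \<Longrightarrow> integrable lborel (\<lambda>r. tri t r * g (x + r))"
  by (rule integrable_real_bound[OF _ _ tri_g_bound]) (auto intro!: integrable_mult_right tri_integrable)

lemma dbl_second_difference_bound: "\<bar>dbl g (x + t) + dbl g (x - t) - 2 * dbl g x\<bar> \<le> G * t^2"
proof -
  have *: "\<bar>dbl g (x + t) + dbl g (x - t) - 2 * dbl g x\<bar> \<le> G * t^2" if t: "t \<ge> 0" for t
  proof -
    have "\<bar>LINT r|lborel. tri t r * g (x + r)\<bar> \<le> (LINT r|lborel. G * tri t r)"
      using t by (intro integral_abs_bound_integral tri_g_integrable tri_g_bound integrable_mult_right tri_integrable)
    then show ?thesis unfolding dbl_second_difference[OF t] using tri_integral[OF t] by simp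
  qed
  show ?thesis using *[of "\<bar>t\<bar>"] by (cases "t \<ge> 0") (auto simp: add.commute add.left_commute)
qed

text \<open>A generalized second derivative of \<open>dbl g\<close> at scale h. The second moment 2
  h^2 of the kernel cancels the 1 / 2 of Taylor's formula, so division by h^2 is the right
  normalization.\<close>

definition mean2 :: "real \<Rightarrow> real \<Rightarrow> real" where
  "mean2 h x = ((LINT s|lborel. kern h s * dbl g (x + s)) - dbl g x) / h^2"

lemma dbl_measurable [measurable]: "dbl g \<in> borel_measurable borel"
  by (rule borel_measurable_continuous_onI[OF dbl_continuous])

lemma dbl_growth: "\<bar>dbl g x\<bar> \<le> (2 * G) * (1 + x^2)"
  using dbl_bound[of x] G_nonneg by (simp add: algebra_simps)

lemma mean2_eq: "h > 0 \<Longrightarrow> mean2 h x = (LINT s|lborel. kern h s * (dbl g (x + s) + dbl g (x - s) - 2 * dbl g x)) / (2 * h^2)"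
  unfolding mean2_def kern_second_difference(1)[OF _ dbl_measurable dbl_growth] by (subst mult_divide_mult_cancel_left) auto

text \<open>The uniformity in both h and x is what later permits passing to the limit under a
  Poisson integral.\<close>

lemma mean2_bound: assumes h: "h > 0" shows "\<bar>mean2 h x\<bar> \<le> G"
proof -
  have le: "\<bar>kern h s * (dbl g (x + s) + dbl g (x - s) - 2 * dbl g x)\<bar> \<le> G * (kern h s * s^2)" for s
    using mult_left_mono[OF dbl_second_difference_bound kern_nonneg[OF h], of s x s] kern_nonneg[OF h, of s]
    by (simp add: abs_mult mult.left_commute[of G])
  have i: "integrable lborel (\<lambda>s. G * (kern h s * s^2))"
    by (intro integrable_mult_right kern_square_integrable h)
  have "\<bar>LINT s|lborel. kern h s * (dbl g (x + s) + dbl g (x - s) - 2 * dbl g x)\<bar> \<le> (LINT s|lborel. G * (kern h s * s^2))"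
    by (rule integral_abs_bound_integral[OF integrable_real_bound[OF i _ le] i le]) measurable
  also have "\<dots> = G * (2 * h^2)" using kern_square_integral[OF h] by simp
  finally show ?thesis unfolding mean2_eq[OF h] using h by (simp add: divide_le_eq)
qed

text \<open>The hypothesis is continuity of g at x in the sense of tent means. Second differences of
  \<open>dbl g\<close> are exactly such means, and \<open>kern_second_moment_limit\<close> transfers
  their limit to the kernel.\<close>

lemma mean2_limit:
  assumes lim: "((\<lambda>t. (LINT r|lborel. tri t r * (g (x + r) - g x)) / t^2) \<longlongrightarrow> 0) (at_right 0)"
  shows "((\<lambda>h. mean2 h x) \<longlongrightarrow> g x) (at_right 0)"
proof -
  define D where "D t = dbl g (x + t) + dbl g (x - t) - 2 * dbl g x" for t
  have [measurable]: "D \<in> borel_measurable borel" unfolding D_def by measurable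
  have "((\<lambda>t. (LINT r|lborel. tri t r * (g (x + r) - g x)) / t^2 + g x) \<longlongrightarrow> 0 + g x) (at_right 0)"
    by (intro tendsto_intros lim)
  moreover have "(LINT r|lborel. tri t r * (g (x + r) - g x)) / t^2 + g x = D t / t^2" if t: "t > 0" for t
  proof -
    have "(LINT r|lborel. tri t r * (g (x + r) - g x)) = D t - t^2 * g x"
      unfolding D_def using t tri_g_integrable[of t x] tri_integrable[of t] tri_integral[of t]
      by (subst dbl_second_difference) (auto simp: right_diff_distrib)
    then show ?thesis using t by (simp add: diff_divide_distrib)
  qed
  ultimately have r: "((\<lambda>t. D t / t^2) \<longlongrightarrow> g x) (at_right 0)"
    by (subst tendsto_cong[OF eventually_at_rightI[of 0 1], symmetric]) auto
  \<comment> \<open>Evenness upgrades the limit from the right to the two-sided limit required by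
    \<open>kern_second_moment_limit\<close>.\<close>
  have "D (- t) = D t" for t by (simp add: D_def)
  then have "((\<lambda>t. D t / t^2) \<longlongrightarrow> g x) (at_left 0)"
    using r by (simp add: filterlim_at_left_to_right)
  with r have "((\<lambda>t. D t / t^2) \<longlongrightarrow> g x) (at 0)" by (simp add: filterlim_split_at)
  then have "((\<lambda>h. (LINT s|lborel. kern h s * D s) / h^2) \<longlongrightarrow> 2 * g x) (at_right 0)"
    by (intro kern_second_moment_limit[where C=G]) (auto simp: D_def dbl_second_difference_bound)
  then have "((\<lambda>h. (LINT s|lborel. kern h s * D s) / h^2 / 2) \<longlongrightarrow> 2 * g x / 2) (at_right 0)"
    by (intro tendsto_intros) auto
  moreover have "(LINT s|lborel. kern h s * D s) / h^2 / 2 = mean2 h x" if "h > 0" for h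
    unfolding mean2_eq[OF that] D_def by simp
  ultimately show ?thesis
    by (subst tendsto_cong[OF eventually_at_rightI[of 0 1], symmetric]) auto
qed

end

section \<open>Vertical means of the Poisson extension\<close>

text \<open>Only the right derivative at the single point a is known, so both values of g are
  compared with g a. With the difference quotient q the integrand is \<sigma> q(h \<sigma>) - (1 +
  \<sigma>) q(h (1 + \<sigma>)), which tends to \<sigma> d - (1 + \<sigma>) d = - d.\<close>

lemma difference_quotient_mean_limit:
  fixes g :: "real \<Rightarrow> real"
  assumes [measurable]: "g \<in> borel_measurable borel" and le: "\<And>s. s \<ge> 0 \<Longrightarrow> \<bar>g s\<bar> \<le> G" and a: "a \<ge> 0"
    and lim: "((\<lambda>s. (g (a + s) - g a) / s) \<longlongrightarrow> d) (at_right 0)"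
  shows "((\<lambda>h. LINT \<sigma>|lborel. indicator {0<..1} \<sigma> * ((g (a + h * \<sigma>) - g (a + h + h * \<sigma>)) / h)) \<longlongrightarrow> - d) (at_right 0)"
proof -
  define q where "q s = (g (a + s) - g a) / s" for s
  have G: "G \<ge> 0" using le[of 0] by simp
  have "eventually (\<lambda>s. dist (q s) d < 1) (at_right 0)"
    using lim unfolding q_def by (rule tendstoD) simp
  then obtain e where e: "e > 0" "\<And>s. 0 < s \<Longrightarrow> s < e \<Longrightarrow> dist (q s) d < 1"
    unfolding eventually_at_right_field by auto
  define B where "B = \<bar>d\<bar> + 1 + 2 * G / e"
  have qB: "\<bar>q s\<bar> \<le> B" if s: "s > 0" for s
  proof (cases "s < e")
    case True
    have "2 * G / e \<ge> 0" using e G by simp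
    with e(2)[OF s True] show ?thesis unfolding dist_real_def B_def by linarith
  next
    case False
    have "\<bar>g (a + s) - g a\<bar> \<le> 2 * G" using le[of "a + s"] le[of a] a s by linarith
    then have "\<bar>q s\<bar> \<le> 2 * G / s" using s by (simp add: q_def divide_right_mono)
    also have "\<dots> \<le> 2 * G / e" using False e G s by (intro divide_left_mono) auto
    finally show ?thesis unfolding B_def by linarith
  qed
  have B: "B \<ge> 0" using qB[of 1] by simp
  have eq: "(g (a + h * \<sigma>) - g (a + h + h * \<sigma>)) / h = \<sigma> * q (h * \<sigma>) - (1 + \<sigma>) * q (h * (1 + \<sigma>))"
    if "h > 0" "\<sigma> > 0" for h \<sigma>
  proof -
    have "\<sigma> * q (h * \<sigma>) = (g (a + h * \<sigma>) - g a) / h" using that by (simp add: q_def)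
    moreover have "(1 + \<sigma>) * q (h * (1 + \<sigma>)) = (g (a + h * (1 + \<sigma>)) - g a) / h"
    proof -
      have "c * (X / (h * c)) = X / h" if "c \<noteq> 0" for c X :: real using that by simp
      from this[of "1 + \<sigma>"] show ?thesis using that by (simp add: q_def)
    qed
    moreover have "a + h * (1 + \<sigma>) = a + h + h * \<sigma>" by (simp add: algebra_simps)
    ultimately show ?thesis by (simp add: diff_divide_distrib)
  qed
  have "((\<lambda>h. LINT \<sigma>|lborel. indicator {0<..1} \<sigma> * ((g (a + h * \<sigma>) - g (a + h + h * \<sigma>)) / h))
      \<longlongrightarrow> (LINT \<sigma>|lborel. indicator {0<..1::real} \<sigma> * - d)) (at_right 0)"
  proof (rule tendsto_lebesgue_integral_dominated)
    show "integrable lborel (\<lambda>\<sigma>. indicator {0<..1::real} \<sigma> * (3 * B))"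
      by (intro integrable_mult_left) (auto simp: integrable_indicator_iff)
    show "norm (indicator {0<..1} \<sigma> * ((g (a + h * \<sigma>) - g (a + h + h * \<sigma>)) / h)) \<le> indicator {0<..1} \<sigma> * (3 * B)"
      if "h \<in> {0<..}" for h \<sigma>
    proof (cases "\<sigma> \<in> {0<..1}")
      case True
      have h: "h > 0" using that by simp
      have "\<bar>\<sigma> * q (h * \<sigma>) - (1 + \<sigma>) * q (h * (1 + \<sigma>))\<bar> \<le> \<bar>\<sigma>\<bar> * \<bar>q (h * \<sigma>)\<bar> + \<bar>1 + \<sigma>\<bar> * \<bar>q (h * (1 + \<sigma>))\<bar>"
        unfolding abs_mult[symmetric] by (rule abs_triangle_ineq4)
      also have "\<dots> \<le> 1 * B + 2 * B"
        using True h by (intro add_mono mult_mono qB) auto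
      finally show ?thesis using eq[OF h, of \<sigma>] True by simp
    qed simp
    show "((\<lambda>h. indicator {0<..1} \<sigma> * ((g (a + h * \<sigma>) - g (a + h + h * \<sigma>)) / h)) \<longlongrightarrow> indicator {0<..1} \<sigma> * - d) (at_right 0)" for \<sigma>
    proof (cases "\<sigma> \<in> {0<..1}")
      case True
      then have \<sigma>: "\<sigma> > 0" by simp
      have *: "((\<lambda>h. q (h * c)) \<longlongrightarrow> d) (at_right 0)" if "c > 0" for c
      proof -
        have "filterlim (\<lambda>h. h * c) (at_right 0) (at_right 0)"
          using that by (auto simp: filterlim_at eventually_at_filter intro!: tendsto_eq_intros)
        then show ?thesis using lim unfolding q_def[symmetric] by (rule filterlim_compose[rotated])
      qed
      have "((\<lambda>h. \<sigma> * q (h * \<sigma>) - (1 + \<sigma>) * q (h * (1 + \<sigma>))) \<longlongrightarrow> \<sigma> * d - (1 + \<sigma>) * d) (at_right 0)"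
        using \<sigma> by (intro tendsto_intros *) auto
      then have "((\<lambda>h. (g (a + h * \<sigma>) - g (a + h + h * \<sigma>)) / h) \<longlongrightarrow> \<sigma> * d - (1 + \<sigma>) * d) (at_right 0)"
        by (rule Lim_transform_eventually) (use eq \<sigma> in \<open>auto intro!: eventually_at_rightI[of 0 1]\<close>)
      then show ?thesis using True by (simp add: algebra_simps)
    qed simp
  qed measurable
  then show ?thesis by simp
qed

text \<open>With N a primitive of g, W k = N (1 + k) - N k. A second difference of W is thus a
  difference of two second differences of N, and each of these is an average of first differences of
  g near 0 or near 1.\<close>

lemma second_mean_limit:
  fixes g :: "real \<Rightarrow> real"
  assumes [measurable]: "g \<in> borel_measurable borel" and le: "\<And>s. s \<ge> 0 \<Longrightarrow> \<bar>g s\<bar> \<le> G"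
    and lim0: "((\<lambda>s. (g s - g 0) / s) \<longlongrightarrow> d0) (at_right 0)"
    and lim1: "((\<lambda>s. (g (1 + s) - g 1) / s) \<longlongrightarrow> d1) (at_right 0)"
  defines "W \<equiv> \<lambda>k. LINT \<eta>|lborel. indicator {0<..1} \<eta> * g (\<eta> + k)"
  shows "((\<lambda>h. (2 * W h - W (2 * h) - W 0) / h^2) \<longlongrightarrow> d0 - d1) (at_right 0)"
proof -
  define N where "N b = (LINT \<eta>|lborel. indicator {0<..b} \<eta> * g \<eta>)" for b
  have int: "integrable lborel (\<lambda>\<eta>. indicator {p<..q} \<eta> * g (\<eta> + k))" if "p + k \<ge> 0" for p q k
  proof (rule integrable_real_bound)
    show "integrable lborel (\<lambda>\<eta>. indicator {p..q} \<eta> * G)"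
      by (intro integrable_mult_left indicator_Icc_integrable)
    show "\<bar>indicator {p<..q} \<eta> * g (\<eta> + k)\<bar> \<le> indicator {p..q} \<eta> * G" for \<eta>
      using le[of "\<eta> + k"] that by (auto simp: indicator_def)
  qed measurable
  have shift: "(LINT \<eta>|lborel. indicator {0<..b} \<eta> * g (\<eta> + k)) = N (b + k) - N k" if "b \<ge> 0" "k \<ge> 0" for b k
  proof -
    have "(LINT \<eta>|lborel. indicator {0<..b} \<eta> * g (\<eta> + k)) = (LINT \<eta>|lborel. indicator {k<..b + k} \<eta> * g \<eta>)"
      using lborel_integral_real_affine[of 1 "\<lambda>\<eta>. indicator {k<..b + k} \<eta> * g \<eta>" k]
      by (simp add: indicator_def add.commute)
    moreover have "N (b + k) = (LINT \<eta>|lborel. indicator {0<..k} \<eta> * g (\<eta> + 0) + indicator {k<..b + k} \<eta> * g (\<eta> + 0))"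
      unfolding N_def using that by (intro Bochner_Integration.integral_cong) (auto simp: indicator_def)
    moreover have "\<dots> = N k + (LINT \<eta>|lborel. indicator {k<..b + k} \<eta> * g \<eta>)"
      unfolding N_def using int[of 0 0 k] int[of k 0 "b + k"] that by simp
    ultimately show ?thesis by simp
  qed
  have W: "W k = N (1 + k) - N k" if "k \<ge> 0" for k
    unfolding W_def using shift[of 1 k] that by simp
  \<comment> \<open>Minus the forward second difference of N at a, divided by h^2.\<close>
  define E where "E a h = (LINT \<sigma>|lborel. indicator {0<..1} \<sigma> * ((g (a + h * \<sigma>) - g (a + h + h * \<sigma>)) / h))" for a h
  have E: "h^2 * E a h = 2 * N (a + h) - N a - N (a + 2 * h)" if h: "h > 0" and a: "a \<ge> 0" for a h
  proof -
    have "h^2 * E a h = h * (LINT \<sigma>|lborel. indicator {0<..h} (h * \<sigma>) * (g (h * \<sigma> + a) - g (h * \<sigma> + (a + h))))"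
      unfolding E_def integral_mult_right_zero[symmetric] using h
      by (intro Bochner_Integration.integral_cong) (auto simp: indicator_def power2_eq_square add_ac zero_less_mult_iff)
    also have "\<dots> = (LINT \<eta>|lborel. indicator {0<..h} \<eta> * (g (\<eta> + a) - g (\<eta> + (a + h))))"
      using lborel_integral_real_affine[of h "\<lambda>\<eta>. indicator {0<..h} \<eta> * (g (\<eta> + a) - g (\<eta> + (a + h)))" 0] h by simp
    also have "\<dots> = (LINT \<eta>|lborel. indicator {0<..h} \<eta> * g (\<eta> + a)) - (LINT \<eta>|lborel. indicator {0<..h} \<eta> * g (\<eta> + (a + h)))"
      using int[of 0 a h] int[of 0 "a + h" h] a h by (simp add: right_diff_distrib)
    also have "\<dots> = (N (h + a) - N a) - (N (h + (a + h)) - N (a + h))"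
      using shift[of h a] shift[of h "a + h"] a h by simp
    also have "\<dots> = 2 * N (a + h) - N a - N (a + 2 * h)" by (simp add: add.commute add.left_commute)
    finally show ?thesis .
  qed
  have e0: "(E 0 \<longlongrightarrow> - d0) (at_right 0)" unfolding E_def
    by (rule difference_quotient_mean_limit[OF _ le]) (use lim0 in auto)
  have e1: "(E 1 \<longlongrightarrow> - d1) (at_right 0)" unfolding E_def
    by (rule difference_quotient_mean_limit[OF _ le]) (use lim1 in auto)
  have "((\<lambda>h. E 1 h - E 0 h) \<longlongrightarrow> - d1 - - d0) (at_right 0)"
    by (intro tendsto_intros e0 e1)
  moreover have "E 1 h - E 0 h = (2 * W h - W (2 * h) - W 0) / h^2" if h: "h > 0" for h
  proof -
    have "h^2 * (E 1 h - E 0 h) = 2 * W h - W (2 * h) - W 0"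
      using E[OF h, of 1] E[OF h, of 0] h by (simp add: W right_diff_distrib)
    then show ?thesis using h by (simp add: field_simps)
  qed
  ultimately show ?thesis
    by (subst tendsto_cong[OF eventually_at_rightI[of 0 1], symmetric]) (auto simp: algebra_simps)
qed

lemma poisson_mult_integrable:
  assumes "a > 0" "f \<in> borel_measurable borel" "\<And>s. \<bar>f s\<bar> \<le> K"
  shows "integrable lborel (\<lambda>s. poisson a s * f s)"
  by (rule integrable_real_bound[OF integrable_mult_right[OF poisson_integrable[OF assms(1)], of K]])
    (use assms poisson_nonneg[of a] in \<open>auto simp: abs_mult mult.commute[of K] intro!: mult_left_mono\<close>)

context bounded_borel
begin

text \<open>For k = 0 this is the V of the overview; by \<open>mean_ext_semigroup\<close> a positive
  k gives the Poisson extension of V at height k.\<close>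

definition mean_ext :: "real \<Rightarrow> real \<Rightarrow> real" where
  "mean_ext x k = (LINT \<eta>|lborel. indicator {0<..1} \<eta> * ext x (\<eta> + k))"

lemma Ioc_integrable: "integrable lborel (\<lambda>\<eta>::real. indicator {0<..1} \<eta> * M)"
  by (intro integrable_mult_left) (auto simp: integrable_indicator_iff)

lemma mean_ext_integrand_bound: "k \<ge> 0 \<Longrightarrow> \<bar>indicator {0<..1} \<eta> * ext x (\<eta> + k)\<bar> \<le> indicator {0<..1} \<eta> * M"
  using ext_bound[of "\<eta> + k" x] by (auto simp: indicator_def)

lemma mean_ext_measurable [measurable (raw)]:
  assumes [measurable]: "f \<in> borel_measurable N"
  shows "(\<lambda>z. mean_ext (f z) k) \<in> borel_measurable N"
  unfolding mean_ext_def by measurable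

lemma mean_ext_bound: "k \<ge> 0 \<Longrightarrow> \<bar>mean_ext x k\<bar> \<le> M"
proof -
  assume k: "k \<ge> 0"
  have "\<bar>mean_ext x k\<bar> \<le> (LINT \<eta>|lborel. indicator {0<..1::real} \<eta> * M)"
    unfolding mean_ext_def
    by (rule integral_abs_bound_integral[OF integrable_real_bound[OF Ioc_integrable _ mean_ext_integrand_bound[OF k]]
        Ioc_integrable mean_ext_integrand_bound[OF k]]) measurable
  then show ?thesis by simp
qed

lemma mean_ext_continuous: "continuous_on UNIV (\<lambda>x. mean_ext x 0)"
  unfolding continuous_on_eq_continuous_at[OF open_UNIV] isCont_def mean_ext_def
proof (intro ballI tendsto_lebesgue_integral_dominated[OF _ _ _ _ Ioc_integrable])
  fix x \<eta> :: real
  show "((\<lambda>x. indicator {0<..1} \<eta> * ext x (\<eta> + 0)) \<longlongrightarrow> indicator {0<..1} \<eta> * ext x (\<eta> + 0)) (at x)"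
    using isCont_ext_x[of \<eta> x] by (cases "\<eta> > 0") (auto simp: isCont_def intro!: tendsto_intros)
qed (use mean_ext_integrand_bound[of 0] in auto)

lemma mean_ext_semigroup:
  assumes a: "a > 0" and k: "k \<ge> 0"
  shows "(LINT s|lborel. poisson a s * mean_ext (x + s) k) = mean_ext x (k + a)"
proof -
  have "(LINT s|lborel. poisson a s * mean_ext (x + s) k)
    = (LINT s|lborel. LINT \<eta>|lborel. poisson a s * (indicator {0<..1} \<eta> * ext (x + s) (\<eta> + k)))"
    by (simp add: mean_ext_def)
  also have "\<dots> = (LINT \<eta>|lborel. LINT s|lborel. poisson a s * (indicator {0<..1} \<eta> * ext (x + s) (\<eta> + k)))"
  proof (rule lborel_integral_swap_product[OF _ _ poisson_integrable[OF a] Ioc_integrable])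
    show "\<bar>poisson a s * (indicator {0<..1} \<eta> * ext (x + s) (\<eta> + k))\<bar> \<le> poisson a s * (indicator {0<..1} \<eta> * M)" for s \<eta>
      unfolding abs_mult[of "poisson a s"] using a poisson_nonneg[of a s]
      by (intro mult_mono mean_ext_integrand_bound k) auto
  qed measurable
  also have "\<dots> = mean_ext x (k + a)"
    unfolding mean_ext_def
  proof (intro Bochner_Integration.integral_cong refl)
    fix \<eta>
    show "(LINT s|lborel. poisson a s * (indicator {0<..1} \<eta> * ext (x + s) (\<eta> + k))) = indicator {0<..1} \<eta> * ext x (\<eta> + (k + a))"
      using ext_semigroup[OF a, of "\<eta> + k" x] k by (cases "\<eta> \<in> {0<..1}") (auto simp: add_ac)
  qed
  finally show ?thesis .
qed

lemma kern_mean_ext: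
  assumes h: "h > 0"
  shows "(LINT s|lborel. kern h s * mean_ext (x + s) 0) = 2 * mean_ext x h - mean_ext x (2 * h)"
proof -
  have i: "integrable lborel (\<lambda>s. poisson a s * mean_ext (x + s) 0)" if "a > 0" for a
    by (rule poisson_mult_integrable[OF that _ mean_ext_bound]) auto
  have "(LINT s|lborel. kern h s * mean_ext (x + s) 0)
    = (LINT s|lborel. 2 * (poisson h s * mean_ext (x + s) 0) - poisson (2 * h) s * mean_ext (x + s) 0)"
    by (simp add: kern_def left_diff_distrib mult.assoc)
  also have "\<dots> = 2 * mean_ext x h - mean_ext x (2 * h)"
    using i[of h] i[of "2 * h"] mean_ext_semigroup[of h 0 x] mean_ext_semigroup[of "2 * h" 0 x] h by simp
  finally show ?thesis .
qed

lemma ext_right_quotient: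
  assumes y: "y > 0" shows "((\<lambda>h. (ext x (y + h) - ext x y) / h) \<longlongrightarrow> ext_dy x y) (at_right 0)"
  using ext_has_dy[OF y, of x] unfolding DERIV_def by (rule filterlim_mono) (auto simp: at_le)

lemma ext_dy_measurable [measurable]: "y > 0 \<Longrightarrow> (\<lambda>x. ext_dy x y) \<in> borel_measurable borel"
  using isCont_ext_dy_x by (intro borel_measurable_continuous_onI) (simp add: continuous_on_eq_continuous_at)

text \<open>\<open>ext_semigroup\<close> differentiated in the height under the integral. From
  height 1 upwards the difference quotients are bounded by M.\<close>

lemma ext_dy_semigroup:
  assumes y: "y > 0" shows "(LINT s|lborel. poisson y s * ext_dy (x + s) 1) = ext_dy x (y + 1)"
proof (rule tendsto_unique[OF trivial_limit_at_right_real])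
  show "((\<lambda>h. LINT s|lborel. poisson y s * ((ext (x + s) (1 + h) - ext (x + s) 1) / h))
      \<longlongrightarrow> (LINT s|lborel. poisson y s * ext_dy (x + s) 1)) (at_right 0)"
  proof (rule tendsto_lebesgue_integral_dominated)
    show "integrable lborel (\<lambda>s. poisson y s * M)" by (intro integrable_mult_left poisson_integrable y)
    show "((\<lambda>h. poisson y s * ((ext (x + s) (1 + h) - ext (x + s) 1) / h)) \<longlongrightarrow> poisson y s * ext_dy (x + s) 1) (at_right 0)" for s
      by (intro tendsto_mult tendsto_const ext_right_quotient) simp
    show "norm (poisson y s * ((ext (x + s) (1 + h) - ext (x + s) 1) / h)) \<le> poisson y s * M" if "h \<in> {0<..}" for h s
    proof -
      have "\<bar>ext (x + s) (1 + h) - ext (x + s) 1\<bar> \<le> M * h"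
        using ext_lipschitz_y[of 1 "1 + h" "x + s"] that by simp
      then have "\<bar>(ext (x + s) (1 + h) - ext (x + s) 1) / h\<bar> \<le> M"
        using that by (simp add: divide_le_eq)
      then show ?thesis unfolding real_norm_def abs_mult using y by (intro mult_mono) (auto simp: poisson_nonneg)
    qed
    show "(\<lambda>s. poisson y s * ext_dy (x + s) 1) \<in> borel_measurable lborel"
      using ext_dy_measurable[of 1] by measurable
  qed measurable
  have "((\<lambda>h. (ext x (y + 1 + h) - ext x (y + 1)) / h) \<longlongrightarrow> ext_dy x (y + 1)) (at_right 0)"
    using y by (intro ext_right_quotient) simp
  moreover have "(ext x (y + 1 + h) - ext x (y + 1)) / h = (LINT s|lborel. poisson y s * ((ext (x + s) (1 + h) - ext (x + s) 1) / h))"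
    if h: "h > 0" for h
  proof -
    have i: "integrable lborel (\<lambda>s. poisson y s * ext (x + s) b)" if "b \<ge> 0" for b
      by (rule poisson_mult_integrable[OF y _ ext_bound[OF that]]) measurable
    have "(LINT s|lborel. poisson y s * ((ext (x + s) (1 + h) - ext (x + s) 1) / h))
       = (LINT s|lborel. (poisson y s * ext (x + s) (1 + h) - poisson y s * ext (x + s) 1) / h)"
      by (simp add: right_diff_distrib)
    also have "\<dots> = ((LINT s|lborel. poisson y s * ext (x + s) (1 + h)) - (LINT s|lborel. poisson y s * ext (x + s) 1)) / h"
      using i[of "1 + h"] i[of 1] h by simp
    finally show ?thesis using ext_semigroup[OF y, of "1 + h" x] ext_semigroup[OF y, of 1 x] h by (simp add: add_ac)
  qed
  ultimately show "((\<lambda>h. LINT s|lborel. poisson y s * ((ext (x + s) (1 + h) - ext (x + s) 1) / h)) \<longlongrightarrow> ext_dy x (y + 1)) (at_right 0)"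
    by (subst tendsto_cong[OF eventually_at_rightI[of 0 1], symmetric]) auto
qed

end

section \<open>The half-Laplacian equation\<close>

lemma holomorphic_Re_0_constant:
  assumes hol: "N holomorphic_on S" and S: "open S" "connected S" and re: "\<And>z. z \<in> S \<Longrightarrow> Re (N z) = 0"
  shows "\<exists>c. \<forall>z\<in>S. N z = c"
proof -
  have "(N has_field_derivative 0) (at z)" if z: "z \<in> S" for z
  proof -
    obtain D where D: "(N has_field_derivative D) (at z)"
      using hol S(1) z by (auto simp: holomorphic_on_open)
    have "Re (e * D) = 0" for e
    proof -
      have c: "((\<lambda>t. z + of_real t * e) has_vector_derivative e) (at 0)"
        by (auto intro!: derivative_eq_intros)
      have "((\<lambda>t. N (z + of_real t * e)) has_vector_derivative e * D) (at 0)"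
        using field_vector_diff_chain_at[OF c, of N D] D by (simp add: o_def)
      then have d: "((\<lambda>t. Re (N (z + of_real t * e))) has_vector_derivative Re (e * D)) (at 0)"
        by (rule bounded_linear.has_vector_derivative[OF bounded_linear_Re])
      define T where "T = {t :: real. z + of_real t * e \<in> S}"
      have "continuous_on UNIV (\<lambda>t::real. z + of_real t * e)" by (intro continuous_intros)
      then have "open T" using open_vimage[OF S(1)] by (simp add: T_def vimage_def)
      moreover have "0 \<in> T" using z by (simp add: T_def)
      ultimately have "((\<lambda>_. 0) has_vector_derivative Re (e * D)) (at 0)"
        using has_vector_derivative_transform_within_open[OF d, of T "\<lambda>_. 0"] re by (auto simp: T_def)
      then show ?thesis
        using vector_derivative_unique_at has_vector_derivative_const by blast
    qed
    \<comment> \<open>The directions 1 and i give Re D = 0 and - Im D = 0.\<close>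
    from this[of 1] this[of \<i>] have "D = 0" by (simp add: complex_eq_iff)
    then show ?thesis using D by simp
  qed
  then obtain c where "\<And>z. z \<in> S \<Longrightarrow> N z = c"
    using DERIV_zero_connected_constant[OF S(2,1) finite.emptyI] holomorphic_on_imp_continuous_on[OF hol] by (metis Diff_empty)
  then show ?thesis by blast
qed

context bounded_borel
begin

text \<open>The second height difference of \<open>mean_ext\<close> is evaluated in two ways.
  Starting at height 0 it equals - h^2 times \<open>mean2\<close> of the source f, by the
  generalized Schwarz theorem. Its Poisson average is the same difference starting at height y,
  where the extension is smooth. Comparing the limits as h tends to 0 yields the identity.\<close>

lemma ext_dy_eq_poisson:
  assumes lim: "\<And>x. (trunc x \<longlongrightarrow> pi * (\<rho> x * w x)) (at_right 0)"
    and \<rho>: "continuous_on UNIV \<rho>" and R: "\<And>x. \<bar>\<rho> x\<bar> \<le> R" and y: "y > 0"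
  shows "(LINT s|lborel. poisson y s * (\<rho> (x + s) * w (x + s))) = - ext_dy x y"
proof -
  have [measurable]: "\<rho> \<in> borel_measurable borel" using \<rho> by (rule borel_measurable_continuous_onI)
  have \<rho>c: "isCont \<rho> x" for x using \<rho> by (simp add: continuous_on_eq_continuous_at)
  have [measurable]: "(\<lambda>x. ext_dy x 1) \<in> borel_measurable borel" by (rule ext_dy_measurable) simp
  \<comment> \<open>- f is the generalized second derivative of V: the vertical derivative at height
    0, which is - \<rho> w by \<open>ext_normal_derivative\<close>, minus the one at height
    1.\<close>
  define f where "f x = \<rho> x * w x + ext_dy x 1" for x
  have fw: "\<bar>\<rho> x * w x\<bar> \<le> R * M" for x
    unfolding abs_mult using R[of x] bound_w[of x] by (intro mult_mono) auto
  have fb: "\<bar>f x\<bar> \<le> R * M + M" for x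
    using fw[of x] ext_dy_bound[of 1 x] by (simp add: f_def)
  have [measurable]: "f \<in> borel_measurable borel" unfolding f_def by measurable
  interpret S: bounded_source f "R * M + M"
    by unfold_locales (use fb in auto)
  have mean: "((\<lambda>h. S.mean2 h x) \<longlongrightarrow> f x) (at_right 0)" for x
  proof (rule S.mean2_limit)
    obtain B where B: "\<And>a. a > 0 \<Longrightarrow> \<bar>trunc x a\<bar> \<le> B" using trunc_bounded[OF lim] by blast
    \<comment> \<open>f (x + r) - f x equals q r - \<rho> x (w x - w (x + r)). The part q tends to 0
      by continuity of \<rho> and of the vertical derivative at height 1; the other part is small
      only in tent mean, by \<open>tri_bound\<close>.\<close>
    define q where "q r = (\<rho> (x + r) - \<rho> x) * w (x + r) + (ext_dy (x + r) 1 - ext_dy x 1)" for r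
    have [measurable]: "q \<in> borel_measurable borel" unfolding q_def by measurable
    have qb: "\<bar>q r\<bar> \<le> 2 * R * M + 2 * M" for r
    proof -
      have "\<bar>(\<rho> (x + r) - \<rho> x) * w (x + r)\<bar> \<le> (2 * R) * M"
        unfolding abs_mult using R[of x] R[of "x + r"] bound_w[of "x + r"] by (intro mult_mono) auto
      then show ?thesis unfolding q_def using ext_dy_bound[of 1 x] ext_dy_bound[of 1 "x + r"] by simp
    qed
    have sh: "((\<lambda>r. x + r) \<longlongrightarrow> x) (at 0)" by (auto intro!: tendsto_eq_intros)
    have ql: "(q \<longlongrightarrow> 0) (at 0)"
    proof (rule Lim_null_comparison)
      show "eventually (\<lambda>r. norm (q r) \<le> \<bar>\<rho> (x + r) - \<rho> x\<bar> * M + \<bar>ext_dy (x + r) 1 - ext_dy x 1\<bar>) (at 0)"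
      proof (intro always_eventually allI)
        fix r
        have "\<bar>(\<rho> (x + r) - \<rho> x) * w (x + r)\<bar> \<le> \<bar>\<rho> (x + r) - \<rho> x\<bar> * M"
          unfolding abs_mult by (intro mult_left_mono bound_w) auto
        then show "norm (q r) \<le> \<bar>\<rho> (x + r) - \<rho> x\<bar> * M + \<bar>ext_dy (x + r) 1 - ext_dy x 1\<bar>"
          unfolding q_def by simp
      qed
      have "((\<lambda>r. \<bar>\<rho> (x + r) - \<rho> x\<bar> * M + \<bar>ext_dy (x + r) 1 - ext_dy x 1\<bar>) \<longlongrightarrow> \<bar>\<rho> x - \<rho> x\<bar> * M + \<bar>ext_dy x 1 - ext_dy x 1\<bar>) (at 0)"
        by (intro tendsto_intros isCont_tendsto_compose[OF \<rho>c sh] isCont_tendsto_compose[OF isCont_ext_dy_x sh]) simp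
      then show "((\<lambda>r. \<bar>\<rho> (x + r) - \<rho> x\<bar> * M + \<bar>ext_dy (x + r) 1 - ext_dy x 1\<bar>) \<longlongrightarrow> 0) (at 0)" by simp
    qed
    have "q 0 = 0" by (simp add: q_def)
    then have l2: "((\<lambda>t. (LINT r|lborel. tri t r * q r) / t^2) \<longlongrightarrow> 0) (at_right 0)"
      by (intro tri_mean_tendsto_0[OF _ qb ql]) auto
    have l1: "((\<lambda>t. (LINT r|lborel. tri t r * (w x - w (x + r))) / t^2) \<longlongrightarrow> 0) (at_right 0)"
    proof (rule Lim_null_comparison)
      show "eventually (\<lambda>t. norm ((LINT r|lborel. tri t r * (w x - w (x + r))) / t^2) \<le> 5 * B * t) (at_right 0)"
      proof (rule eventually_at_rightI[of 0 1])
        fix t :: real assume "t \<in> {0<..<1}"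
        then have t: "t > 0" by simp
        have "norm ((LINT r|lborel. tri t r * (w x - w (x + r))) / t^2) \<le> 5 * B * t^3 / t^2"
          using tri_bound[OF t B] by (simp add: divide_right_mono)
        then show "norm ((LINT r|lborel. tri t r * (w x - w (x + r))) / t^2) \<le> 5 * B * t"
          using t by (simp add: power2_eq_square power3_eq_cube)
      qed simp
      show "((\<lambda>t. 5 * B * t) \<longlongrightarrow> 0) (at_right 0)" by (auto intro!: tendsto_eq_intros)
    qed
    have "((\<lambda>t. (LINT r|lborel. tri t r * q r) / t^2 - \<rho> x * ((LINT r|lborel. tri t r * (w x - w (x + r))) / t^2)) \<longlongrightarrow> 0 - \<rho> x * 0) (at_right 0)"
      by (intro tendsto_intros l1 l2)
    moreover have "(LINT r|lborel. tri t r * q r) / t^2 - \<rho> x * ((LINT r|lborel. tri t r * (w x - w (x + r))) / t^2)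
        = (LINT r|lborel. tri t r * (f (x + r) - f x)) / t^2" if t: "t > 0" for t
    proof -
      have i: "integrable lborel (\<lambda>r. tri t r * p r)" if "p \<in> borel_measurable borel" "\<And>r. \<bar>p r\<bar> \<le> K" for p K
      proof (rule integrable_real_bound)
        show "integrable lborel (\<lambda>r. tri t r * K)" using t by (intro integrable_mult_left tri_integrable) simp
        show "\<bar>tri t r * p r\<bar> \<le> tri t r * K" for r
          using that(2)[of r] tri_nonneg[of t r] by (simp add: abs_mult mult_left_mono)
      qed (use that in measurable)
      have "(LINT r|lborel. tri t r * (f (x + r) - f x))
        = (LINT r|lborel. tri t r * q r - \<rho> x * (tri t r * (w x - w (x + r))))"
        by (intro Bochner_Integration.integral_cong) (auto simp: f_def q_def algebra_simps)
      also have "\<dots> = (LINT r|lborel. tri t r * q r) - \<rho> x * (LINT r|lborel. tri t r * (w x - w (x + r)))"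
        using i[OF _ qb] i[of "\<lambda>r. w x - w (x + r)" "2 * M"] diff_bound by simp
      finally show ?thesis by (simp add: diff_divide_distrib)
    qed
    ultimately show "((\<lambda>t. (LINT r|lborel. tri t r * (f (x + r) - f x)) / t^2) \<longlongrightarrow> 0) (at_right 0)"
      by (subst tendsto_cong[OF eventually_at_rightI[of 0 1], symmetric]) auto
  qed
  define T where "T h x = 2 * mean_ext x h - mean_ext x (2 * h) - mean_ext x 0" for h x
  have T_lim: "((\<lambda>h. T h x / h^2) \<longlongrightarrow> - f x) (at_right 0)" for x
  proof -
    have 1: "((\<lambda>s. (ext x s - ext x 0) / s) \<longlongrightarrow> - (\<rho> x * w x)) (at_right 0)"
      using ext_normal_derivative[OF lim] by simp
    have "((\<lambda>h. T h x / h^2) \<longlongrightarrow> - (\<rho> x * w x) - ext_dy x 1) (at_right 0)"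
      unfolding T_def mean_ext_def
      by (rule second_mean_limit[OF _ ext_bound 1 ext_right_quotient]) auto
    then show ?thesis by (simp add: f_def)
  qed
  \<comment> \<open>The generalized second derivatives of the two summands are - f and f.\<close>
  define \<Phi> where "\<Phi> x = mean_ext x 0 + dbl f x" for x
  have \<Phi>c: "continuous_on UNIV \<Phi>" unfolding \<Phi>_def
    by (intro continuous_intros mean_ext_continuous S.dbl_continuous)
  have [measurable]: "\<Phi> \<in> borel_measurable borel" using \<Phi>c by (rule borel_measurable_continuous_onI)
  define C where "C = M + 2 * (R * M + M)"
  have \<Phi>b: "\<bar>\<Phi> x\<bar> \<le> C * (1 + x^2)" for x
  proof -
    have "\<bar>\<Phi> x\<bar> \<le> M * 1 + 2 * (R * M + M) * (1 + x^2)"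
      unfolding \<Phi>_def using mean_ext_bound[of 0 x] S.dbl_growth[of x] by simp
    also have "M * 1 \<le> M * (1 + x^2)" by (intro mult_left_mono M_nonneg) simp
    finally show ?thesis unfolding C_def by (simp add: algebra_simps)
  qed
  have split: "(LINT s|lborel. kern h s * \<Phi> (x + s)) - \<Phi> x = T h x + h^2 * S.mean2 h x" if h: "h > 0" for h x
  proof -
    have "integrable lborel (\<lambda>s. kern h s * mean_ext (x + s) 0)"
    proof (rule kern_mult_integrable[OF h, where C=M])
      fix s
      have "M * 1 \<le> M * (1 + s^2)" by (intro mult_left_mono M_nonneg) simp
      then show "\<bar>mean_ext (x + s) 0\<bar> \<le> M * (1 + s^2)" using mean_ext_bound[of 0 "x + s"] by simp
    qed measurable
    moreover have "integrable lborel (\<lambda>s. kern h s * dbl f (x + s))"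
      by (rule kern_second_difference(2)[OF h S.dbl_measurable S.dbl_growth])
    ultimately show ?thesis
      using kern_mean_ext[OF h, of x] h unfolding \<Phi>_def S.mean2_def T_def by (simp add: distrib_left)
  qed
  have "((\<lambda>h. ((LINT s|lborel. kern h s * \<Phi> (x + s)) - \<Phi> x) / h^2) \<longlongrightarrow> 0) (at_right 0)" for x
  proof -
    have "((\<lambda>h. T h x / h^2 + S.mean2 h x) \<longlongrightarrow> - f x + f x) (at_right 0)"
      by (intro tendsto_intros T_lim mean)
    moreover have "T h x / h^2 + S.mean2 h x = ((LINT s|lborel. kern h s * \<Phi> (x + s)) - \<Phi> x) / h^2" if "h > 0" for h
      unfolding split[OF that] using that by (simp add: add_divide_distrib)
    ultimately show ?thesis
      by (subst tendsto_cong[OF eventually_at_rightI[of 0 1], symmetric]) auto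
  qed
  then obtain m b where aff: "\<And>x. \<Phi> x = m * x + b"
    using affine_of_kern_limit[OF \<Phi>c \<Phi>b] by blast
  \<comment> \<open>Second differences of an affine function vanish, so the relation between T and
    \<open>mean2\<close> is exact for every h and not just asymptotic.\<close>
  have T_eq: "T h x = - (h^2 * S.mean2 h x)" if h: "h > 0" for h x
  proof -
    have "\<Phi> (x + s) + \<Phi> (x - s) - 2 * \<Phi> x = 0" for s by (simp add: aff algebra_simps)
    then have "(LINT s|lborel. kern h s * \<Phi> (x + s)) - \<Phi> x = 0"
      using kern_second_difference(1)[OF h \<open>\<Phi> \<in> borel_measurable borel\<close> \<Phi>b, of x] by simp
    then show ?thesis using split[OF h, of x] by simp
  qed
  \<comment> \<open>The pointwise limit of \<open>mean2\<close> is integrated against the Poisson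
    kernel, with the uniform bound R M + M as majorant.\<close>
  have "((\<lambda>h. - (LINT s|lborel. poisson y s * S.mean2 h (x + s))) \<longlongrightarrow> - (LINT s|lborel. poisson y s * f (x + s))) (at_right 0)"
  proof (intro tendsto_minus tendsto_lebesgue_integral_dominated)
    show "integrable lborel (\<lambda>s. poisson y s * (R * M + M))" by (intro integrable_mult_left poisson_integrable y)
    show "((\<lambda>h. poisson y s * S.mean2 h (x + s)) \<longlongrightarrow> poisson y s * f (x + s)) (at_right 0)" for s
      by (intro tendsto_intros mean)
    show "norm (poisson y s * S.mean2 h (x + s)) \<le> poisson y s * (R * M + M)" if "h \<in> {0<..}" for h s
      unfolding real_norm_def abs_mult using y S.mean2_bound[of h "x + s"] that
      by (intro mult_mono) (auto simp: poisson_nonneg)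
    show "(\<lambda>s. poisson y s * S.mean2 h (x + s)) \<in> borel_measurable lborel" for h
      unfolding S.mean2_def by measurable
  qed measurable
  moreover have "- (LINT s|lborel. poisson y s * S.mean2 h (x + s))
     = (2 * mean_ext x (h + y) - mean_ext x (2 * h + y) - mean_ext x (0 + y)) / h^2" if h: "h > 0" for h
  proof -
    have i: "integrable lborel (\<lambda>s. poisson y s * mean_ext (x + s) k)" if "k \<ge> 0" for k
      by (rule poisson_mult_integrable[OF y _ mean_ext_bound[OF that]]) measurable
    have e: "S.mean2 h z = - (T h z / h^2)" for z using T_eq[OF h, of z] h by simp
    have "- (LINT s|lborel. poisson y s * S.mean2 h (x + s))
      = (LINT s|lborel. (2 * (poisson y s * mean_ext (x + s) h) - poisson y s * mean_ext (x + s) (2 * h) - poisson y s * mean_ext (x + s) 0) / h^2)"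
      unfolding e T_def by (simp add: right_diff_distrib mult.left_commute)
    also have "\<dots> = (2 * (LINT s|lborel. poisson y s * mean_ext (x + s) h) - (LINT s|lborel. poisson y s * mean_ext (x + s) (2 * h))
        - (LINT s|lborel. poisson y s * mean_ext (x + s) 0)) / h^2"
      using i[of h] i[of "2 * h"] i[of 0] h by simp
    also have "\<dots> = (2 * mean_ext x (h + y) - mean_ext x (2 * h + y) - mean_ext x (0 + y)) / h^2"
      using h by (simp add: mean_ext_semigroup[OF y])
    finally show ?thesis .
  qed
  ultimately have A: "((\<lambda>h. (2 * mean_ext x (h + y) - mean_ext x (2 * h + y) - mean_ext x (0 + y)) / h^2)
      \<longlongrightarrow> - (LINT s|lborel. poisson y s * f (x + s))) (at_right 0)"
    by (subst tendsto_cong[OF eventually_at_rightI[of 0 1], symmetric]) auto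
  \<comment> \<open>The same quotient computed directly from the vertical derivatives at the heights
    y and y + 1. The latter cancels against the Poisson average of the height 1 term in f.\<close>
  have "((\<lambda>h. (2 * mean_ext x (h + y) - mean_ext x (2 * h + y) - mean_ext x (0 + y)) / h^2)
      \<longlongrightarrow> ext_dy x y - ext_dy x (y + 1)) (at_right 0)"
    unfolding mean_ext_def add.assoc[symmetric]
  proof (rule second_mean_limit[where g="\<lambda>s. ext x (s + y)" and G=M])
    show "((\<lambda>s. (ext x (s + y) - ext x (0 + y)) / s) \<longlongrightarrow> ext_dy x y) (at_right 0)"
      using ext_right_quotient[OF y, of x] by (simp add: add.commute)
    show "((\<lambda>s. (ext x (1 + s + y) - ext x (1 + y)) / s) \<longlongrightarrow> ext_dy x (y + 1)) (at_right 0)"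
      using ext_right_quotient[of "y + 1" x] y by (simp add: add_ac)
  qed (use y ext_bound in auto)
  then have "ext_dy x y - ext_dy x (y + 1) = - (LINT s|lborel. poisson y s * f (x + s))"
    by (rule tendsto_unique[OF trivial_limit_at_right_real _ A])
  also have "(LINT s|lborel. poisson y s * f (x + s))
     = (LINT s|lborel. poisson y s * (\<rho> (x + s) * w (x + s)) + poisson y s * ext_dy (x + s) 1)"
    by (simp add: f_def distrib_left)
  also have "\<dots> = (LINT s|lborel. poisson y s * (\<rho> (x + s) * w (x + s))) + ext_dy x (y + 1)"
  proof -
    have "integrable lborel (\<lambda>s. poisson y s * (\<rho> (x + s) * w (x + s)))"
      by (rule poisson_mult_integrable[OF y _ fw]) measurable
    moreover have "integrable lborel (\<lambda>s. poisson y s * ext_dy (x + s) 1)"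
      using ext_dy_bound[of 1] by (intro poisson_mult_integrable[OF y, where K=M]) auto
    ultimately show ?thesis using ext_dy_semigroup[OF y, of x] by simp
  qed
  finally show ?thesis by simp
qed

text \<open>Partial fractions: the regularized Cauchy kernel minus z / (1 + t^2) equals (1 + z^2) /
  ((t - z) (1 + t^2)). The subtracted term integrates to 0 against w by the mean condition, so the
  weight 1 / (1 + t^2) becomes division by 1 + z^2.\<close>

lemma poisson_weighted_eq:
  assumes mean: "(LINT t|lborel. w t / (1 + t^2)) = 0" and z: "Im z > 0" "z \<noteq> \<i>"
  shows "(LINT s|lborel. poisson (Im z) s * (2 / (1 + (Re z + s)^2) * w (Re z + s))) = Re (2 * cauchy z / (1 + z^2))"
proof -
  define y x where "y = Im z" and "x = Re z"
  have zxy: "z = Complex x y" by (simp add: x_def y_def)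
  have nz: "1 + z^2 \<noteq> 0"
  proof -
    have "1 + z^2 = (z - \<i>) * (z + \<i>)" by (simp add: algebra_simps power2_eq_square)
    moreover have "z + \<i> \<noteq> 0" using z by (auto simp: complex_eq_iff)
    ultimately show ?thesis using z by auto
  qed
  define k where "k t = 1 / (of_real t - z) - of_real (t / (1 + t^2))" for t
  have i1: "integrable lborel (\<lambda>t. of_real (w t) * k t)"
    unfolding k_def by (rule cauchy_integrable[OF z(1)])
  have i2: "integrable lborel (\<lambda>t. w t / (1 + t^2))"
    using integrable_mult_w[OF integrable_mult_right[OF poisson_integrable[of 1], of pi]]
    by (simp add: poisson_def add.commute)
  then have i3: "integrable lborel (\<lambda>t. of_real (w t / (1 + t^2)) * z)"
    by (intro integrable_mult_left integrable_of_real)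
  have "(LINT s|lborel. poisson y s * (2 / (1 + (x + s)^2) * w (x + s))) = (LINT t|lborel. poisson y (t - x) * (2 / (1 + t^2) * w t))"
    using lborel_integral_real_affine[of 1 "\<lambda>t. poisson y (t - x) * (2 / (1 + t^2) * w t)" x] by simp
  also have "\<dots> = (LINT t|lborel. Re (2 / (of_real pi * \<i> * (1 + z^2)) * (of_real (w t) * k t - of_real (w t / (1 + t^2)) * z)))"
  proof (intro Bochner_Integration.integral_cong refl)
    fix t :: real
    define p q :: complex where "p = of_real t - z" and "q = of_real (1 + t^2)"
    have p: "p \<noteq> 0" using of_real_neq_upper[OF z(1)] by (simp add: p_def)
    have "1 + t^2 > 0" by (rule add_pos_nonneg) auto
    then have q: "q \<noteq> 0" unfolding q_def by (simp only: of_real_eq_0_iff)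
    have "k t - z / q = 1 / p - (of_real t + z) / q" by (simp add: k_def p_def q_def add_divide_distrib)
    also have "\<dots> = (q - p * (of_real t + z)) / (p * q)" using p q by (simp add: field_simps)
    also have "q - p * (of_real t + z) = 1 + z^2" by (simp add: p_def q_def algebra_simps power2_eq_square)
    finally have e: "k t - z / q = (1 + z^2) / (p * q)" .
    have "2 / (of_real pi * \<i> * (1 + z^2)) * (of_real (w t) * k t - of_real (w t / (1 + t^2)) * z)
      = 2 / (of_real pi * \<i> * (1 + z^2)) * (of_real (w t) * (k t - z / q))"
      by (simp add: q_def right_diff_distrib)
    also have "\<dots> = of_real (2 * w t / (pi * (1 + t^2))) * (1 / (\<i> * p))"
      unfolding e using nz by (simp add: q_def)
    also have "Re \<dots> = 2 * w t / (pi * (1 + t^2)) * Re (1 / (\<i> * p))" by (simp only: times_complex.simps Re_complex_of_real Im_complex_of_real mult_zero_left diff_0_right)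
    also have "Re (1 / (\<i> * p)) = y / ((t - x)^2 + y^2)"
      by (simp add: p_def zxy Re_divide add.commute)
    finally show "poisson y (t - x) * (2 / (1 + t^2) * w t)
        = Re (2 / (of_real pi * \<i> * (1 + z^2)) * (of_real (w t) * k t - of_real (w t / (1 + t^2)) * z))"
      by (simp add: poisson_def mult_ac)
  qed
  also have "\<dots> = Re (LINT t|lborel. 2 / (of_real pi * \<i> * (1 + z^2)) * (of_real (w t) * k t - of_real (w t / (1 + t^2)) * z))"
    by (intro integral_Re integrable_mult_right Bochner_Integration.integrable_diff i1 i3)
  also have "(LINT t|lborel. 2 / (of_real pi * \<i> * (1 + z^2)) * (of_real (w t) * k t - of_real (w t / (1 + t^2)) * z))
     = 2 / (of_real pi * \<i> * (1 + z^2)) * ((LINT t|lborel. of_real (w t) * k t) - of_real (LINT t|lborel. w t / (1 + t^2)) * z)"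
    using i1 i3 by (simp only: integral_mult_right_zero integral_mult_left_zero Bochner_Integration.integral_diff integral_complex_of_real)
  also have "\<dots> = 2 * cauchy z / (1 + z^2)"
    unfolding mean cauchy_def k_def by simp
  finally show ?thesis unfolding x_def y_def .
qed

text \<open>Thus mean zero says that \<open>cauchy\<close> vanishes at i, the zero of 1 + z^2 in the
  half-plane.\<close>

lemma cauchy_i: "cauchy \<i> = of_real ((LINT t|lborel. w t / (1 + t^2)) / pi)"
proof -
  have "cauchy \<i> = (LINT t|lborel. \<i> * of_real (w t / (1 + t^2))) / (of_real pi * \<i>)"
    unfolding cauchy_def cauchy_kernel_i by (simp add: mult.commute)
  also have "(LINT t|lborel. \<i> * of_real (w t / (1 + t^2))) = \<i> * of_real (LINT t|lborel. w t / (1 + t^2))"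
    by (simp only: integral_mult_right_zero integral_complex_of_real)
  finally show ?thesis by simp
qed

lemma half_laplacian_solution:
  assumes mean: "(LINT t|lborel. w t / (1 + t^2)) = 0"
    and lim: "\<And>x. (trunc x \<longlongrightarrow> pi * (2 / (1 + x^2) * w x)) (at_right 0)"
  shows "\<exists>K. \<forall>x. w x = Re (K * (of_real x - \<i>) / (of_real x + \<i>))"
proof -
  \<comment> \<open>The point where 1 + z^2 vanishes is removed; the rest stays connected, so that a
    single constant \<kappa> arises.\<close>
  define S where "S = {z. Im z > 0} - {\<i>}"
  have S: "open S" unfolding S_def using open_upper by (intro open_Diff) auto
  have "connected {z. Im z > 0}" by (intro convex_connected convex_halfspace_Im_gt)
  then have conn: "connected S" unfolding S_def
    by (intro connected_open_delete open_upper) auto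
  have nz: "1 + z^2 \<noteq> 0" if "z \<in> S" for z
  proof -
    have "1 + z^2 = (z - \<i>) * (z + \<i>)" by (simp add: algebra_simps power2_eq_square)
    moreover have "z + \<i> \<noteq> 0" using that by (auto simp: complex_eq_iff S_def)
    ultimately show ?thesis using that by (auto simp: S_def)
  qed
  have sub: "S \<subseteq> {z. Im z > 0}" by (auto simp: S_def)
  define N where "N z = - \<i> * cauchy' z - 2 * cauchy z / (1 + z^2)" for z
  have holN: "N holomorphic_on S" unfolding N_def
    by (intro holomorphic_intros holomorphic_on_subset[OF cauchy'_holomorphic sub] holomorphic_on_subset[OF cauchy_holomorphic sub] nz)
  have "Re (N z) = 0" if "z \<in> S" for z
  proof -
    have z: "Im z > 0" "z \<noteq> \<i>" using that by (auto simp: S_def)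
    have nz': "1 + x^2 \<noteq> 0" for x :: real using add_pos_nonneg[of 1 "x^2"] by auto
    have "(LINT s|lborel. poisson (Im z) s * (2 / (1 + (Re z + s)^2) * w (Re z + s))) = - ext_dy (Re z) (Im z)"
    proof (rule ext_dy_eq_poisson[OF lim _ _ z(1), where R=2])
      show "continuous_on UNIV (\<lambda>x::real. 2 / (1 + x^2))" using nz' by (intro continuous_intros) auto
      show "\<bar>2 / (1 + x^2)\<bar> \<le> 2" for x :: real
        using add_pos_nonneg[of 1 "x^2"] by (simp add: divide_le_eq)
    qed
    then show ?thesis using poisson_weighted_eq[OF mean z] by (simp add: N_def ext_dy_def)
  qed
  then obtain \<kappa> where \<kappa>: "\<And>z. z \<in> S \<Longrightarrow> N z = \<kappa>"
    using holomorphic_Re_0_constant[OF holN S conn] by blast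
  \<comment> \<open>Cleared of denominators the equation also holds at i, where both 1 + z^2 and
    \<open>cauchy\<close> vanish.\<close>
  have ode: "(1 + z^2) * cauchy' z = 2 * \<i> * cauchy z + \<i> * \<kappa> * (1 + z^2)" if z: "Im z > 0" for z
  proof (cases "z = \<i>")
    case True
    then show ?thesis using cauchy_i by (simp add: mean)
  next
    case False
    then have "z \<in> S" using z by (simp add: S_def)
    from \<kappa>[OF this] have "- \<i> * cauchy' z = 2 * cauchy z / (1 + z^2) + \<kappa>"
      unfolding N_def by (simp add: diff_eq_eq add.commute)
    then have "(1 + z^2) * (- \<i> * cauchy' z) = (1 + z^2) * (2 * cauchy z / (1 + z^2)) + \<kappa> * (1 + z^2)"
      by (simp only: distrib_left mult.commute)
    also have "(1 + z^2) * (2 * cauchy z / (1 + z^2)) = 2 * cauchy z" using nz[OF \<open>z \<in> S\<close>] by simp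
    finally have "(1 + z^2) * (- \<i> * cauchy' z) = 2 * cauchy z + \<kappa> * (1 + z^2)" .
    then have "\<i> * ((1 + z^2) * (- \<i> * cauchy' z)) = \<i> * (2 * cauchy z + \<kappa> * (1 + z^2))" by simp
    then show ?thesis by (simp add: algebra_simps)
  qed
  \<comment> \<open>Compare the derivatives of both sides of \<open>ode\<close> at \<open>\<i>\<close>.\<close>
  have "\<kappa> = 0"
  proof -
    obtain D where D: "(cauchy' has_field_derivative D) (at \<i>)"
      using cauchy'_holomorphic[unfolded holomorphic_on_open[OF open_upper], rule_format, of \<i>] by auto
    have "((\<lambda>z. (1 + z^2) * cauchy' z) has_field_derivative 2 * \<i> * cauchy' \<i>) (at \<i>)"
      by (rule derivative_eq_intros D refl)+ simp
    moreover have "((\<lambda>z. 2 * \<i> * cauchy z + \<i> * \<kappa> * (1 + z^2)) has_field_derivative 2 * \<i> * cauchy' \<i> + \<i> * \<kappa> * (2 * \<i>)) (at \<i>)"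
      by (rule derivative_eq_intros cauchy_deriv refl | simp | simp add: mult.commute[of \<kappa>])+
    then have "((\<lambda>z. (1 + z^2) * cauchy' z) has_field_derivative 2 * \<i> * cauchy' \<i> + \<i> * \<kappa> * (2 * \<i>)) (at \<i>)"
      by (rule has_field_derivative_transform_within_open[OF _ open_upper]) (use ode in auto)
    ultimately have "2 * \<i> * cauchy' \<i> = 2 * \<i> * cauchy' \<i> + \<i> * \<kappa> * (2 * \<i>)" by (rule DERIV_unique)
    then show ?thesis by simp
  qed
  \<comment> \<open>(z - i) / (z + i) solves (1 + z^2) F' = 2 i F; E is the quotient of
    \<open>cauchy\<close> by this solution.\<close>
  define E where "E z = cauchy z * (z + \<i>) / (z - \<i>)" for z
  have "(E has_field_derivative 0) (at z)" if z: "z \<in> S" for z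
  proof -
    have im: "Im z > 0" and ne: "z - \<i> \<noteq> 0" using z by (auto simp: S_def)
    have "(E has_field_derivative ((cauchy' z * (z + \<i>) + cauchy z) * (z - \<i>) - cauchy z * (z + \<i>)) / ((z - \<i>) * (z - \<i>))) (at z)"
      unfolding E_def by (rule derivative_eq_intros cauchy_deriv im ne refl | simp add: ne)+
    moreover have "(cauchy' z * (z + \<i>) + cauchy z) * (z - \<i>) - cauchy z * (z + \<i>) = (1 + z^2) * cauchy' z - 2 * \<i> * cauchy z"
      by (simp add: algebra_simps power2_eq_square)
    ultimately show ?thesis using ode[OF im] \<open>\<kappa> = 0\<close> by simp
  qed
  moreover have "continuous_on S E"
    using calculation by (intro DERIV_continuous_on) (auto intro: has_field_derivative_at_within)
  ultimately obtain K where K: "\<And>z. z \<in> S \<Longrightarrow> E z = K"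
    using DERIV_zero_connected_constant[OF conn S finite.emptyI, of E] by (metis Diff_empty)
  have "w x = Re (K * (of_real x - \<i>) / (of_real x + \<i>))" for x
  proof (rule tendsto_unique[OF trivial_limit_at_right_real])
    \<comment> \<open>Existence of the normal derivative forces convergence to w x at every x, so
      the final formula holds everywhere and not merely almost everywhere.\<close>
    show "(ext x \<longlongrightarrow> w x) (at_right 0)"
    proof -
      have "((\<lambda>y. (ext x y - w x) / y * y + w x) \<longlongrightarrow> - (2 / (1 + x^2) * w x) * 0 + w x) (at_right 0)"
        by (intro tendsto_intros ext_normal_derivative lim)
      then show ?thesis
        unfolding mult_zero_right add_0_left
        by (rule Lim_transform_eventually) (auto intro!: eventually_at_rightI[of 0 1])
    qed
    have "of_real x + \<i> \<noteq> 0" by (auto simp: complex_eq_iff)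
    then have "((\<lambda>y. Re (K * (Complex x y - \<i>) / (Complex x y + \<i>))) \<longlongrightarrow> Re (K * (Complex x 0 - \<i>) / (Complex x 0 + \<i>))) (at_right 0)"
      unfolding Complex_eq by (intro tendsto_intros) auto
    moreover have "Re (K * (Complex x y - \<i>) / (Complex x y + \<i>)) = ext x y" if y: "y \<in> {0<..<1}" for y
    proof -
      have z: "Complex x y \<in> S" using y by (auto simp: S_def complex_eq_iff)
      have "Complex x y - \<i> \<noteq> 0" "Complex x y + \<i> \<noteq> 0" using y by (auto simp: complex_eq_iff)
      then have "K * (Complex x y - \<i>) / (Complex x y + \<i>) = cauchy (Complex x y)"
        unfolding K[OF z, symmetric] E_def by simp
      then show ?thesis using Re_cauchy y by simp
    qed
    ultimately show "(ext x \<longlongrightarrow> Re (K * (of_real x - \<i>) / (of_real x + \<i>))) (at_right 0)"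
      by (subst tendsto_cong[OF eventually_at_rightI[of 0 1], symmetric]) (auto simp: Complex_eq)
  qed
  then show ?thesis by blast
qed

end

section \<open>Reduction to a scalar equation\<close>

lemma one_plus_square_pos: "1 + x^2 > (0::real)" "x^2 + 1 > (0::real)"
  by (auto intro: add_pos_nonneg add_nonneg_pos)

lemma one_plus_square_neq: "1 + x^2 \<noteq> (0::real)" "x^2 + 1 \<noteq> (0::real)"
  using one_plus_square_pos[of x] by auto

lemma inner_real2: "(a :: real^2) \<bullet> b = a $ 1 * b $ 1 + a $ 2 * b $ 2"
  by (simp add: inner_vec_def sum_2)

text \<open>The chordal distance under stereographic projection. Its factor (x - y)^2 cancels the
  singularity of the kernel, and what is left produces the mean c in the scalar equation.\<close>

lemma Z1_inner: "Z1 x \<bullet> Z1 y = 1 - 2 * (x - y)^2 / ((1 + x^2) * (1 + y^2))"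
proof -
  have "Z1 x \<bullet> Z1 y = (2 * x * (2 * y) + (x^2 - 1) * (y^2 - 1)) / ((1 + x^2) * (1 + y^2))"
    by (simp add: inner_real2 Z1_def add.commute flip: add_divide_distrib)
  also have "2 * x * (2 * y) + (x^2 - 1) * (y^2 - 1) = (1 + x^2) * (1 + y^2) - 2 * (x - y)^2"
    by (simp add: power2_eq_square algebra_simps)
  finally show ?thesis by (simp add: diff_divide_distrib one_plus_square_neq)
qed

text \<open>\<open>Z1\<close> is \<open>U\<close> turned by a right angle, so the two have the same
  inner products.\<close>

lemma U_diff: "(norm (U x - U y))^2 = 4 * (x - y)^2 / ((1 + x^2) * (1 + y^2))"
proof -
  have "U x \<bullet> U y = Z1 x \<bullet> Z1 y" for x y
    by (simp add: inner_real2 Z1_def U_def)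
  then have "(norm (U x - U y))^2 = 2 - 2 * (Z1 x \<bullet> Z1 y)"
    by (simp add: power2_norm_eq_inner inner_diff_left inner_diff_right inner_commute Z1_inner)
  then show ?thesis by (simp add: Z1_inner)
qed

lemma tangent_eq:
  assumes "a \<bullet> U x = 0" shows "a = (a \<bullet> Z1 x) *\<^sub>R Z1 x"
proof -
  have p: "(x^2 - 1)^2 + (2 * x)^2 = (x^2 + 1)^2" by (simp add: power2_eq_square algebra_simps)
  define u t where "u = (x^2 - 1) / (x^2 + 1)" and "t = 2 * x / (x^2 + 1)"
  have ut: "u^2 + t^2 = 1"
    unfolding u_def t_def power_divide using p one_plus_square_neq(2)[of x] by (simp flip: add_divide_distrib)
  have o: "a $ 1 * u = a $ 2 * t" using assms by (simp add: inner_real2 U_def u_def t_def)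
  have "a $ 1 = (a $ 1 * t + a $ 2 * u) * t"
  proof -
    have "(a $ 1 * t + a $ 2 * u) * t = a $ 1 * t^2 + (a $ 2 * t) * u" by (simp add: power2_eq_square algebra_simps)
    also have "\<dots> = a $ 1 * (u^2 + t^2)" unfolding o[symmetric] by (simp add: power2_eq_square algebra_simps)
    finally show ?thesis by (simp add: ut)
  qed
  moreover have "a $ 2 = (a $ 1 * t + a $ 2 * u) * u"
  proof -
    have "(a $ 1 * t + a $ 2 * u) * u = (a $ 1 * u) * t + a $ 2 * u^2" by (simp add: power2_eq_square algebra_simps)
    also have "\<dots> = a $ 2 * (u^2 + t^2)" unfolding o by (simp add: power2_eq_square algebra_simps)
    finally show ?thesis by (simp add: ut)
  qed
  ultimately show ?thesis
    by (simp add: vec_eq_iff forall_2 inner_real2 Z1_def flip: u_def t_def)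
qed

lemma cauchy_density_integrable: "integrable lborel (\<lambda>y::real. 1 / (1 + y^2))"
  and cauchy_density_integral: "(LINT y|lborel. 1 / (1 + y^2)) = pi"
proof -
  have e: "1 / (1 + y^2) = pi * poisson 1 y" for y by (simp add: poisson_def add.commute)
  show "integrable lborel (\<lambda>y::real. 1 / (1 + y^2))" "(LINT y|lborel. 1 / (1 + y^2)) = pi"
    unfolding e using poisson_integrable[of 1] poisson_integral[of 1] by auto
qed

lemma energy_U_eq: "energy_U x = 2 / (1 + x^2)"
proof -
  have "(LINT y|lborel. (norm (U x - U y))^2 / \<bar>x - y\<bar>^2) = (LINT y|lborel. 4 / (1 + x^2) * (1 / (1 + y^2)))"
  proof (rule integral_cong_AE)
    have "AE y in lborel. y \<noteq> x" by (rule AE_lborel_singleton)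
    then show "AE y in lborel. (norm (U x - U y))^2 / \<bar>x - y\<bar>^2 = 4 / (1 + x^2) * (1 / (1 + y^2))"
      by eventually_elim (simp add: U_diff)
  qed (simp_all add: U_diff)
  then have "energy_U x = (1 / (2 * pi)) * (4 / (1 + x^2) * pi)"
    unfolding energy_U_def integral_mult_right_zero cauchy_density_integral by (simp only:)
  then show ?thesis by simp
qed

text \<open>Measurability is not a hypothesis; it is recovered from the integrability contained in
  the principal value, which yields it away from each base point x.\<close>

lemma lin_eq_measurable:
  assumes sol: "\<forall>x. lin_eq_at v x" shows "v \<in> borel_measurable borel"
proof -
  have m: "(\<lambda>y. indicator {y. 1 < \<bar>x - y\<bar>} y *\<^sub>R v y) \<in> borel_measurable borel" for x
  proof -
    obtain P where "pv_has_value (\<lambda>y. (1 / \<bar>x - y\<bar>^2) *\<^sub>R (v x - v y)) x P"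
      using sol unfolding lin_eq_at_def half_laplacian_at_def by blast
    then have "set_integrable lborel {y. 1 < \<bar>x - y\<bar>} (\<lambda>y. (1 / \<bar>x - y\<bar>^2) *\<^sub>R (v x - v y))"
      unfolding pv_has_value_def by auto
    then have [measurable]: "(\<lambda>y. indicator {y. 1 < \<bar>x - y\<bar>} y *\<^sub>R ((1 / \<bar>x - y\<bar>^2) *\<^sub>R (v x - v y))) \<in> borel_measurable borel"
      unfolding set_integrable_def by (auto dest: borel_measurable_integrable)
    have "(\<lambda>y. indicator {y. 1 < \<bar>x - y\<bar>} y *\<^sub>R v x - \<bar>x - y\<bar>^2 *\<^sub>R (indicator {y. 1 < \<bar>x - y\<bar>} y *\<^sub>R ((1 / \<bar>x - y\<bar>^2) *\<^sub>R (v x - v y)))) \<in> borel_measurable borel"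
      by measurable
    also have "(\<lambda>y. indicator {y. 1 < \<bar>x - y\<bar>} y *\<^sub>R v x - \<bar>x - y\<bar>^2 *\<^sub>R (indicator {y. 1 < \<bar>x - y\<bar>} y *\<^sub>R ((1 / \<bar>x - y\<bar>^2) *\<^sub>R (v x - v y))))
      = (\<lambda>y. indicator {y. 1 < \<bar>x - y\<bar>} y *\<^sub>R v y)"
      by (auto simp: fun_eq_iff indicator_def)
    finally show ?thesis .
  qed
  \<comment> \<open>Two base points suffice, since the excluded intervals [-1, 1] and [4, 6] are
    disjoint.\<close>
  have "v = (\<lambda>y. if 1 < \<bar>y\<bar> then indicator {y. 1 < \<bar>0 - y\<bar>} y *\<^sub>R v y else indicator {y. 1 < \<bar>5 - y\<bar>} y *\<^sub>R v y)"
    by (auto simp: fun_eq_iff indicator_def)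
  also have "\<dots> \<in> borel_measurable borel"
    using m[of 0] m[of 5] by measurable
  finally show ?thesis .
qed

text \<open>Pairing with \<open>Z1 x\<close> removes the multiple of \<open>U x\<close>. By
  \<open>Z1_inner\<close> the paired integrand is the scalar one for w plus an integrable function,
  whose integral supplies the mean term.\<close>

lemma lin_eq_trunc_limit:
  fixes v :: "real \<Rightarrow> real^2"
  assumes tangent: "\<forall>x. v x \<bullet> U x = 0" and sol: "lin_eq_at v x"
    and w: "bounded_borel (\<lambda>y. v y \<bullet> Z1 y) M"
  defines "w \<equiv> \<lambda>y. v y \<bullet> Z1 y"
  shows "((\<lambda>e. LINT r|lborel. indicator {r. e < \<bar>r\<bar>} r * ((w x - w (x + r)) / r^2))
    \<longlongrightarrow> pi * (2 / (1 + x^2) * (w x - (LINT y|lborel. w y / (1 + y^2)) / pi))) (at_right 0)"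
proof -
  interpret bounded_borel w M using w unfolding w_def .
  define g where "g y = (1 / \<bar>x - y\<bar>^2) *\<^sub>R (v x - v y)" for y
  have vw: "v y = w y *\<^sub>R Z1 y" for y
    unfolding w_def by (rule tangent_eq) (use tangent in simp)
  obtain P N where P: "pv_has_value g x P" and eq: "(1 / pi) *\<^sub>R P = energy_U x *\<^sub>R v x + (N / pi) *\<^sub>R U x"
    using sol unfolding lin_eq_at_def half_laplacian_at_def g_def by auto
  have "(1 / pi) * (P \<bullet> Z1 x) = energy_U x * w x"
  proof -
    have "U x \<bullet> Z1 x = 0" by (simp add: inner_real2 U_def Z1_def)
    then have "((1 / pi) *\<^sub>R P) \<bullet> Z1 x = energy_U x * w x"
      unfolding eq by (simp add: inner_add_left w_def)
    then show ?thesis by simp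
  qed
  then have PZ: "P \<bullet> Z1 x = pi * (2 / (1 + x^2) * w x)" by (simp add: energy_U_eq field_simps)
  \<comment> \<open>What remains of w y (1 - \<open>Z1 y \<bullet> Z1 x\<close>) after division by
    (x - y)^2.\<close>
  define q where "q y = 2 / (1 + x^2) * (w y / (1 + y^2))" for y
  have [measurable]: "q \<in> borel_measurable borel" unfolding q_def by measurable
  have wi: "integrable lborel (\<lambda>y. w y / (1 + y^2))"
    using integrable_mult_w[OF cauchy_density_integrable] by simp
  have qi: "integrable lborel q" unfolding q_def by (intro integrable_mult_right wi)
  define A where "A e = {y. e < \<bar>x - y\<bar>}" for e
  have [measurable]: "A e \<in> sets borel" for e unfolding A_def by measurable
  have gZ: "indicator (A e) y * (g y \<bullet> Z1 x) = indicator (A e) y * ((w x - w y) / (y - x)^2) + indicator (A e) y * q y" if "e > 0" for e y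
  proof (cases "y \<in> A e")
    case True
    then have ne: "(y - x)^2 \<noteq> 0" using that by (auto simp: A_def)
    have "g y \<bullet> Z1 x = (1 / (y - x)^2) * (w x - w y * (Z1 y \<bullet> Z1 x))"
      unfolding g_def vw[of x] vw[of y] using Z1_inner[of x x]
      by (simp add: inner_diff_left power2_commute)
    also have "\<dots> = (w x - w y) / (y - x)^2 + q y"
    proof -
      have "(1 / d) * (X - Y * (1 - 2 * d / k)) = (X - Y) / d + 2 * Y / k" if "d \<noteq> 0" for d X Y k :: real
        using that by (simp add: field_simps)
      from this[OF ne] show ?thesis unfolding Z1_inner q_def by (simp add: mult.commute)
    qed
    finally show ?thesis using True by simp
  qed simp
  have int: "integrable lborel (\<lambda>y. indicator (A e) y *\<^sub>R g y)" if "e > 0" for e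
    using P that unfolding pv_has_value_def set_integrable_def A_def by auto
  have 1: "((\<lambda>e. (LINT y|lborel. indicator (A e) y *\<^sub>R g y) \<bullet> Z1 x) \<longlongrightarrow> P \<bullet> Z1 x) (at_right 0)"
    using P unfolding pv_has_value_def set_lebesgue_integral_def A_def by (intro tendsto_inner tendsto_const) auto
  \<comment> \<open>The point y = x lies in no set A e, hence the value 0 there in the pointwise
    limit.\<close>
  have 2: "((\<lambda>e. LINT y|lborel. indicator (A e) y * q y) \<longlongrightarrow> (LINT y|lborel. (if y = x then 0 else q y))) (at_right 0)"
  proof (rule tendsto_lebesgue_integral_dominated)
    show "integrable lborel (\<lambda>y. \<bar>q y\<bar>)" using qi by (rule integrable_abs)
    show "norm (indicator (A e) y * q y) \<le> \<bar>q y\<bar>" for e y by (auto simp: indicator_def)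
    show "((\<lambda>e. indicator (A e) y * q y) \<longlongrightarrow> (if y = x then 0 else q y)) (at_right 0)" for y
    proof (rule Lim_transform_eventually[OF tendsto_const])
      show "eventually (\<lambda>e. (if y = x then 0 else q y) = indicator (A e) y * q y) (at_right 0)"
      proof (cases "y = x")
        case True
        then show ?thesis by (auto simp: A_def intro!: eventually_at_rightI[of 0 1])
      next
        case False
        then show ?thesis by (intro eventually_at_rightI[of 0 "\<bar>x - y\<bar>"]) (auto simp: A_def)
      qed
    qed
  qed measurable
  have "AE y in lborel. y \<noteq> x" by (rule AE_lborel_singleton)
  then have "AE y in lborel. (if y = x then 0 else q y) = q y" by eventually_elim simp
  then have "(LINT y|lborel. (if y = x then 0 else q y)) = (LINT y|lborel. q y)"
    by (intro integral_cong_AE) measurable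
  also have "\<dots> = 2 / (1 + x^2) * (LINT y|lborel. w y / (1 + y^2))"
    unfolding q_def by (rule integral_mult_right_zero)
  finally have qint: "(LINT y|lborel. (if y = x then 0 else q y)) = 2 / (1 + x^2) * (LINT y|lborel. w y / (1 + y^2))" .
  have "((\<lambda>e. (LINT y|lborel. indicator (A e) y *\<^sub>R g y) \<bullet> Z1 x - (LINT y|lborel. indicator (A e) y * q y))
     \<longlongrightarrow> P \<bullet> Z1 x - (LINT y|lborel. (if y = x then 0 else q y))) (at_right 0)"
    by (intro tendsto_diff 1 2)
  also have "P \<bullet> Z1 x - (LINT y|lborel. (if y = x then 0 else q y))
      = pi * (2 / (1 + x^2) * (w x - (LINT y|lborel. w y / (1 + y^2)) / pi))"
    unfolding PZ qint by (simp add: right_diff_distrib)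
  finally show ?thesis
  proof (rule Lim_transform_eventually)
    show "eventually (\<lambda>e. (LINT y|lborel. indicator (A e) y *\<^sub>R g y) \<bullet> Z1 x - (LINT y|lborel. indicator (A e) y * q y)
      = (LINT r|lborel. indicator {r. e < \<bar>r\<bar>} r * ((w x - w (x + r)) / r^2))) (at_right 0)"
    proof (rule eventually_at_rightI[of 0 1])
      fix e :: real assume "e \<in> {0<..<1}"
      then have e: "e > 0" by simp
      have i2: "integrable lborel (\<lambda>y. indicator (A e) y * q y)"
        by (rule Bochner_Integration.integrable_bound[OF qi]) (auto simp: indicator_def)
      have i1: "integrable lborel (\<lambda>y. indicator (A e) y * (g y \<bullet> Z1 x))"
        using integrable_inner_left[OF int[OF e], of "Z1 x"] by simp
      have "(LINT y|lborel. indicator (A e) y *\<^sub>R g y) \<bullet> Z1 x = (LINT y|lborel. indicator (A e) y * (g y \<bullet> Z1 x))"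
        using integral_inner_left[OF int[OF e], of "Z1 x"] by simp
      then have "(LINT y|lborel. indicator (A e) y *\<^sub>R g y) \<bullet> Z1 x - (LINT y|lborel. indicator (A e) y * q y)
        = (LINT y|lborel. indicator (A e) y * (g y \<bullet> Z1 x) - indicator (A e) y * q y)"
        using i1 i2 by simp
      also have "\<dots> = (LINT y|lborel. indicator (A e) y * ((w x - w y) / (y - x)^2))"
        unfolding gZ[OF e] by simp
      also have "\<dots> = (LINT r|lborel. indicator {r. e < \<bar>r\<bar>} r * ((w x - w (x + r)) / r^2))"
        using lborel_integral_real_affine[of 1 "\<lambda>y. indicator (A e) y * ((w x - w y) / (y - x)^2)" x]
        by (simp add: A_def indicator_def)
      finally show "(LINT y|lborel. indicator (A e) y *\<^sub>R g y) \<bullet> Z1 x - (LINT y|lborel. indicator (A e) y * q y)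
        = (LINT r|lborel. indicator {r. e < \<bar>r\<bar>} r * ((w x - w (x + r)) / r^2))" .
    qed simp
  qed
qed

theorem theorem1p1:
  fixes v :: "real \<Rightarrow> real^2"
  assumes tangent: "\<forall>x. v x \<bullet> U x = 0"
    and bnd: "bounded (range v)"
    and sol: "\<forall>x. lin_eq_at v x"
  shows "\<exists>c1 c2 c3 :: real. \<forall>x. v x = c1 *\<^sub>R Z1 x + c2 *\<^sub>R Z2 x + c3 *\<^sub>R Z3 x"
proof -
  define w where "w x = v x \<bullet> Z1 x" for x
  have [measurable]: "v \<in> borel_measurable borel" using sol by (rule lin_eq_measurable)
  have "Z1 \<in> borel_measurable borel"
  proof (rule borel_measurable_continuous_onI)
    have "\<forall>i. continuous_on UNIV (\<lambda>x. Z1 x $ i)"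
      unfolding forall_2 Z1_def vector_2 by (intro conjI continuous_intros) (simp_all add: one_plus_square_neq)
    then show "continuous_on UNIV Z1" using continuous_on_vec_lambda[of UNIV "\<lambda>i x. Z1 x $ i"] by simp
  qed
  then have [measurable]: "w \<in> borel_measurable borel" unfolding w_def by measurable
  obtain M where M: "\<And>x. norm (v x) \<le> M" using bnd by (auto simp: bounded_iff)
  have "norm (Z1 x) = 1" for x by (simp add: norm_eq_sqrt_inner Z1_inner)
  then have wM: "\<bar>w x\<bar> \<le> M" for x
    unfolding w_def using Cauchy_Schwarz_ineq2[of "v x" "Z1 x"] M[of x] by simp
  \<comment> \<open>Truncations see only differences of w, so subtracting its mean leaves them
    unchanged and produces mean zero.\<close>
  define c where "c = (LINT y|lborel. w y / (1 + y^2)) / pi"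
  interpret W: bounded_borel w M by unfold_locales (use wM in auto)
  interpret W0: bounded_borel "\<lambda>x. w x - c" "M + \<bar>c\<bar>"
  proof
    show "\<bar>w x - c\<bar> \<le> M + \<bar>c\<bar>" for x using wM[of x] by linarith
  qed measurable
  have "\<exists>K. \<forall>x. w x - c = Re (K * (of_real x - \<i>) / (of_real x + \<i>))"
  proof (rule W0.half_laplacian_solution)
    have "integrable lborel (\<lambda>y. w y / (1 + y^2))"
      using W.integrable_mult_w[OF cauchy_density_integrable] by simp
    then have "(LINT t|lborel. w t / (1 + t^2) - c * (1 / (1 + t^2))) = (LINT t|lborel. w t / (1 + t^2)) - c * pi"
      using cauchy_density_integrable cauchy_density_integral by (subst Bochner_Integration.integral_diff) (auto simp del: times_divide_eq_right)
    then show "(LINT t|lborel. (w t - c) / (1 + t^2)) = 0"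
      by (simp add: diff_divide_distrib c_def)
    show "(W0.trunc x \<longlongrightarrow> pi * (2 / (1 + x^2) * (w x - c))) (at_right 0)" for x
    proof -
      have "W0.trunc x = (\<lambda>e. LINT r|lborel. indicator {r. e < \<bar>r\<bar>} r * ((w x - w (x + r)) / r^2))"
        by (simp add: fun_eq_iff W0.trunc_def)
      then show ?thesis
        using lin_eq_trunc_limit[OF tangent sol[rule_format, of x], of M] W.bounded_borel_axioms
        unfolding c_def w_def by (simp only:)
    qed
  qed
  then obtain K where K: "\<And>x. w x = c + Re (K * (of_real x - \<i>) / (of_real x + \<i>))"
    by (metis add.commute diff_add_cancel)
  \<comment> \<open>(x - i) / (x + i) has real part 1 - 2 / (x^2 + 1) and imaginary part - 2 x /
    (x^2 + 1); the factors - 2 / (x^2 + 1) and - 2 x / (x^2 + 1) are those turning \<open>Z1\<close>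
    into \<open>Z2\<close> and \<open>Z3\<close>. The sign of Im K comes from the real part of a
    product.\<close>
  have "v x = (c + Re K) *\<^sub>R Z1 x + Re K *\<^sub>R Z2 x + (- Im K) *\<^sub>R Z3 x" for x
  proof -
    have "(of_real x - \<i>) / (of_real x + \<i>) = Complex ((x^2 - 1) / (x^2 + 1)) (- 2 * x / (x^2 + 1))"
      by (simp add: complex_eq_iff Re_divide Im_divide power2_eq_square)
    then have "K * (of_real x - \<i>) / (of_real x + \<i>) = K * Complex ((x^2 - 1) / (x^2 + 1)) (- 2 * x / (x^2 + 1))"
      by (metis times_divide_eq_right)
    then have "w x = c + (Re K * ((x^2 - 1) / (x^2 + 1)) - Im K * (- 2 * x / (x^2 + 1)))"
      using K[of x] by (simp only: times_complex.simps complex.sel)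
    also have "(x^2 - 1) / (x^2 + 1) = 1 - 2 / (x^2 + 1)"
      using one_plus_square_neq[of x] by (simp add: field_simps)
    finally have w: "w x = (c + Re K) + Re K * (- 2 / (x^2 + 1)) + (- Im K) * (- 2 * x / (x^2 + 1))"
      by (simp add: algebra_simps)
    define p where "p = x^2 + 1"
    have Z2: "Z2 x = (- 2 / (x^2 + 1)) *\<^sub>R Z1 x"
      unfolding Z1_def Z2_def p_def[symmetric]
      by (simp add: vec_eq_iff forall_2 power2_eq_square[of p] right_diff_distrib) (metis minus_diff_eq minus_divide_left)
    have Z3: "Z3 x = (- 2 * x / (x^2 + 1)) *\<^sub>R Z1 x"
      by (simp add: vec_eq_iff forall_2 Z1_def Z3_def power2_eq_square algebra_simps) (metis minus_diff_eq minus_divide_left)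
    have "v x = w x *\<^sub>R Z1 x" unfolding w_def by (rule tangent_eq) (use tangent in simp)
    then show ?thesis unfolding w Z2 Z3 by (simp add: scaleR_add_left scaleR_diff_left)
  qed
  then show ?thesis by blast
qed

end
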